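(* Let $\alpha\in(0,1]$, let $Z$ be a Banach space, $A\in C(\mathbb{R}_+,\mathcal{B}(Z))$ and $B\in C_b(\mathbb{R}_+,\mathcal{B}(Z))$. Assume that $\mathcal{T}^\alpha x=A(t)x$ admits a nonuniform Mittag-Leffler dichotomy in $\mathbb{R}_+$ with projections $P(t)$ and constants $\hat N_1,\hat N_2,\hat\beta_1,\hat\beta_2>0$, $\epsilon\ge0$, and that there is a constant $\delta$ with $\|B(t)\|\le\delta/E_\alpha(\epsilon,t)$ for $t\in\mathbb{R}_+$. If $$\theta:=\delta\left(\frac{\hat N_1}{\hat\beta_1}+\frac{\hat N_2}{\hat\beta_2}\right)<1,\qquad \epsilon<\min\{\hat\beta_1,\hat\beta_2\},$$ then, denoting by $\hat T(t,s)$ the evolution operator of $\mathcal{T}^\alpha x=[A(t)+B(t)]x$, there exist projections $\hat P:\mathbb{R}_+\to\mathcal{B}(Z)$ such that $$\hat T(t,s)\hat P(s)=\hat P(t)\hat T(t,s),\qquad t\ge s,\ t,s\in\mathbb{R}_+,$$ and constants $K_i,\lambda_i>0$ ($i=1,2$) such that $$\|\hat T(t,s)|\mathrm{Im}\,\hat P(s)\|\le K_1\frac{E_\alpha(\lambda_1,s)}{E_\alpha(\lambda_1,t)}E_\alpha(\epsilon,s),\qquad t\ge s\ge0,$$ $$\|\hat T(t,s)|\mathrm{Im}(\mathrm{Id}-\hat P(s))\|\le K_2\frac{E_\alpha(\lambda_2,t)}{E_\alpha(\lambda_2,s)}E_\alpha(\epsilon,s),\qquad s\ge t\ge0,$$ where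 $K_i=\dfrac{\hat N_i}{1-\theta}$ and $\lambda_i=\hat\beta_i-\dfrac{\delta\hat N_i}{1-\theta}$ for $i=1,2$.
   Context: $\mathbb{R}_+=[0,\infty)$. $\mathcal{B}(Z)$ is the Banach space of bounded linear operators on $Z$ with the operator norm; $C_b$ denotes bounded continuous functions; $S|V$ denotes the restriction of an operator $S$ to a subspace $V$. For $\alpha\in(0,1]$, $\mathcal{T}^\alpha g(t):=\lim_{\varepsilon\to0}\frac{g(t+\varepsilon|t|^{1-\alpha})-g(t)}{\varepsilon}$ (so $\mathcal{T}^\alpha g(t)=|t|^{1-\alpha}g'(t)$ for $t\ne0$), with $\mathcal{T}^\alpha g(0):=\lim_{t\to0}\mathcal{T}^\alpha g(t)$ if this limit exists; solutions are continuous functions satisfying the equation. $E_\alpha(\lambda,t):=\exp(\lambda t^\alpha/\alpha)$ for $t\ge0$. The evolution operators $T(t,s)$ of a linear equation are the bounded linear operators with $x(t)=T(t,s)x(s)$ for every solution $x$; they satisfy $T(t,t)=\mathrm{Id}$, $T(t,s)T(s,\tau)=T(t,\tau)$, $T(t,s)^{-1}=T(s,t)$. The equation $\mathcal{T}^\alpha x=A(t)x$ with evolution operator $T(t,s)$ admits a nonuniform Mittag-Leffler dichotomy in $\mathbb{R}_+$ if there are projections $P(t)\in\mathcal{B}(Z)$ ($P(t)^2=P(t)$), $t\in\mathbb{R}_+$, with $T(t,s)P(s)=P(t)T(t,s)$ for $t\ge s$, and constants $\hat N_i,\hat\beta_i>0$ ($i=1,2$), $\epsilon\ge0$ such that for $t,s\in\mathbb{R}_+$: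 $\|T(t,s)P(s)\|\le\hat N_1\frac{E_\alpha(\hat\beta_1,s)}{E_\alpha(\hat\beta_1,t)}E_\alpha(\epsilon,s)$ for $t\ge s$, and $\|T(t,s)(\mathrm{Id}-P(s))\|\le\hat N_2\frac{E_\alpha(\hat\beta_2,t)}{E_\alpha(\hat\beta_2,s)}E_\alpha(\epsilon,s)$ for $s\ge t$.
   Formalization: The explicit λ_i can be negative (Z=ℝ, A=−1, P=Id, B=0, N̂_i=β̂_i=1, ε=0, δ=0.4 gives λ_i=−1), so λ_i>0 is not claimed for them; both bounds hold with the stated K_i, λ_i of any sign and, for the same projections, with some positive K_i', λ_i'. *)

theory Defs
  imports "HOL-Analysis.Analysis"
begin

text \<open>
  The space \<open>Z\<close> is a real Banach space \<open>'z::banach\<close>, and its bounded operators are \<open>'z \<Rightarrow>\<^sub>L 'z\<close>.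
  Functions on the half-line are total functions on \<open>real\<close> constrained only on \<open>{0..}\<close>.
\<close>

definition has_conf_deriv_nz :: "real \<Rightarrow> (real \<Rightarrow> 'z::real_normed_vector) \<Rightarrow> 'z \<Rightarrow> real \<Rightarrow> bool" where
  "has_conf_deriv_nz \<alpha> g D t \<longleftrightarrow>
     ((\<lambda>h. (g (t + h * \<bar>t\<bar> powr (1 - \<alpha>)) - g t) /\<^sub>R h) \<longlongrightarrow> D) (at 0)"

text \<open>
  Conformable derivative of order \<open>\<alpha>\<close> for functions on the half-line. At \<open>0\<close> it is by
  definition the limit of the derivatives at \<open>t \<noteq> 0\<close>; since the domain is the half-line, this is
  the limit from the right.
\<close>

definition has_conf_deriv :: "real \<Rightarrow> (real \<Rightarrow> 'z::real_normed_vector) \<Rightarrow> 'z \<Rightarrow> real \<Rightarrow> bool" where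
  "has_conf_deriv \<alpha> g D t \<longleftrightarrow>
     (if t = 0
      then \<exists>d. (\<forall>\<^sub>F r in at_right 0. has_conf_deriv_nz \<alpha> g (d r) r) \<and> (d \<longlongrightarrow> D) (at_right 0)
      else has_conf_deriv_nz \<alpha> g D t)"

definition conf_solution ::
    "real \<Rightarrow> (real \<Rightarrow> 'z::banach \<Rightarrow>\<^sub>L 'z) \<Rightarrow> (real \<Rightarrow> 'z) \<Rightarrow> bool" where
  "conf_solution \<alpha> C x \<longleftrightarrow>
     continuous_on {0..} x \<and> (\<forall>t\<ge>0. has_conf_deriv \<alpha> x (blinfun_apply (C t) (x t)) t)"

text \<open>
  Only meaningful for \<open>t, s \<ge> 0\<close>. There, for \<open>0 < \<alpha> \<le> 1\<close> and \<open>C\<close> continuous on \<open>{0..}\<close>, every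
  initial value at time \<open>s\<close> has a unique solution, so the description determines the operator.
\<close>

definition evolution_op ::
    "real \<Rightarrow> (real \<Rightarrow> 'z::banach \<Rightarrow>\<^sub>L 'z) \<Rightarrow> real \<Rightarrow> real \<Rightarrow> 'z \<Rightarrow>\<^sub>L 'z" where
  "evolution_op \<alpha> C t s = (THE S. \<forall>x. conf_solution \<alpha> C x \<longrightarrow> x t = blinfun_apply S (x s))"

definition conf_exp :: "real \<Rightarrow> real \<Rightarrow> real \<Rightarrow> real" where
  "conf_exp \<alpha> \<mu> t = exp (\<mu> * t powr \<alpha> / \<alpha>)"

definition projection_family :: "(real \<Rightarrow> 'z::banach \<Rightarrow>\<^sub>L 'z) \<Rightarrow> bool" where
  "projection_family P \<longleftrightarrow> (\<forall>t\<ge>0. P t o\<^sub>L P t = P t)"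

definition invariant_under ::
    "(real \<Rightarrow> real \<Rightarrow> 'z::banach \<Rightarrow>\<^sub>L 'z) \<Rightarrow> (real \<Rightarrow> 'z \<Rightarrow>\<^sub>L 'z) \<Rightarrow> bool" where
  "invariant_under T P \<longleftrightarrow> (\<forall>t s. 0 \<le> s \<and> s \<le> t \<longrightarrow> T t s o\<^sub>L P s = P t o\<^sub>L T t s)"

definition nonuniform_Mittag_Leffler_dichotomy ::
    "real \<Rightarrow> (real \<Rightarrow> 'z::banach \<Rightarrow>\<^sub>L 'z) \<Rightarrow> (real \<Rightarrow> 'z \<Rightarrow>\<^sub>L 'z)
      \<Rightarrow> real \<Rightarrow> real \<Rightarrow> real \<Rightarrow> real \<Rightarrow> real \<Rightarrow> bool" where
  "nonuniform_Mittag_Leffler_dichotomy \<alpha> A P N1 N2 \<beta>1 \<beta>2 \<epsilon> \<longleftrightarrow>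
     N1 > 0 \<and> N2 > 0 \<and> \<beta>1 > 0 \<and> \<beta>2 > 0 \<and> \<epsilon> \<ge> 0 \<and>
     projection_family P \<and> invariant_under (evolution_op \<alpha> A) P \<and>
     (\<forall>t s. 0 \<le> s \<and> s \<le> t \<longrightarrow>
        norm (evolution_op \<alpha> A t s o\<^sub>L P s)
          \<le> N1 * (conf_exp \<alpha> \<beta>1 s / conf_exp \<alpha> \<beta>1 t) * conf_exp \<alpha> \<epsilon> s) \<and>
     (\<forall>t s. 0 \<le> t \<and> t \<le> s \<longrightarrow>
        norm (evolution_op \<alpha> A t s o\<^sub>L (id_blinfun - P s))
          \<le> N2 * (conf_exp \<alpha> \<beta>2 t / conf_exp \<alpha> \<beta>2 s) * conf_exp \<alpha> \<epsilon> s)"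

text \<open>Operator norm of the restriction \<open>S|V\<close>, in the form of \<^const>\<open>onorm\<close> (recall \<open>0 / 0 = 0\<close>).\<close>

definition restr_norm :: "('z::banach \<Rightarrow>\<^sub>L 'z) \<Rightarrow> 'z set \<Rightarrow> real" where
  "restr_norm S V = (SUP v\<in>V. norm (blinfun_apply S v) / norm v)"

definition restricted_dichotomy_bounds ::
    "real \<Rightarrow> (real \<Rightarrow> real \<Rightarrow> 'z::banach \<Rightarrow>\<^sub>L 'z) \<Rightarrow> (real \<Rightarrow> 'z \<Rightarrow>\<^sub>L 'z)
      \<Rightarrow> real \<Rightarrow> real \<Rightarrow> real \<Rightarrow> real \<Rightarrow> real \<Rightarrow> bool" where
  "restricted_dichotomy_bounds \<alpha> T P K1 K2 l1 l2 \<epsilon> \<longleftrightarrow>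
     (\<forall>t s. 0 \<le> s \<and> s \<le> t \<longrightarrow>
        restr_norm (T t s) (range (blinfun_apply (P s)))
          \<le> K1 * (conf_exp \<alpha> l1 s / conf_exp \<alpha> l1 t) * conf_exp \<alpha> \<epsilon> s) \<and>
     (\<forall>t s. 0 \<le> t \<and> t \<le> s \<longrightarrow>
        restr_norm (T t s) (range (blinfun_apply (id_blinfun - P s)))
          \<le> K2 * (conf_exp \<alpha> l2 t / conf_exp \<alpha> l2 s) * conf_exp \<alpha> \<epsilon> s)"

end

theory Submission
  imports Defs "HOL-Real_Asymp.Real_Asymp"
begin

text \<open>
  In the time \<open>\<tau> = t\<^sup>\<alpha> / \<alpha>\<close> the conformable equation becomes an ordinary one and the
  Mittag-Leffler weights become exponentials. With \<open>X\<close> the fundamental solution of the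
  unperturbed equation and \<open>P\<close> its projection at time \<open>0\<close>, the operator
  \<open>(\<Gamma> Y)(t) = X(t) (P + \<integral>\<^sub>0\<^sup>t X\<inverse> B Y - \<integral>\<^sub>0\<^sup>\<infinity> (1 - P) X\<inverse> B Y)\<close>
  is a \<open>\<theta>\<close>-contraction on bounded operator-valued functions, since the weight \<open>e\<^sup>\<epsilon>\<^sup>\<tau>\<close> of the
  dichotomy cancels against the decay of \<open>B\<close>. Its fixed point \<open>Y\<close> gives a projection \<open>R = Y(0)\<close>
  with the kernel of \<open>P\<close>, and transporting \<open>R\<close> by the perturbed evolution gives the projections.

  For the bounds, \<open>u(t) = \<parallel>x(t)\<parallel>\<close> satisfies \<open>u \<le> f + L u\<close> with a positive integral operator \<open>L\<close>
  of norm at most \<open>\<theta>\<close>. If \<open>f + L g \<le> g\<close>, then \<open>u \<le> m + g\<close> implies \<open>u \<le> \<theta> m + g\<close>, and iterating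
  gives \<open>u \<le> g\<close>; both \<open>g = K e\<^sup>-\<^sup>\<lambda>\<^sup>t\<close> with the rate \<open>\<lambda>\<close> of the statement (if positive) and one with
  a small positive \<open>\<lambda>\<close> qualify.
\<close>

section \<open>Linear differential equations on the half-line\<close>

text \<open>Iterated from a constant bound, this step produces the terms
  \<open>M ^ n * t ^ n / fact n\<close>, which give both uniqueness and the convergence of the
  Picard series.\<close>

lemma power_bound_integral:
  fixes g :: "real \<Rightarrow> 'a::banach"
  assumes "0 \<le> t" "t \<le> T" and g: "continuous_on {0..T} g"
    and bd: "\<And>\<tau>. 0 \<le> \<tau> \<Longrightarrow> \<tau> \<le> T \<Longrightarrow> norm (g \<tau>) \<le> c * \<tau> ^ n"
  shows "norm (integral {0..t} g) \<le> c * t ^ Suc n / Suc n"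
proof -
  have hi: "((\<lambda>\<tau>. c * \<tau> ^ n) has_integral (c * t ^ Suc n / Suc n - c * 0 ^ Suc n / Suc n)) {0..t}"
  proof (rule fundamental_theorem_of_calculus[OF \<open>0 \<le> t\<close>])
    fix x assume "x \<in> {0..t}"
    have "((\<lambda>a. c * a ^ Suc n / Suc n) has_real_derivative c * (Suc n * x ^ n) / Suc n) (at x within {0..t})"
      using DERIV_cdivide[OF DERIV_cmult[OF DERIV_pow[of "Suc n" x "{0..t}"], of c], of "real (Suc n)"] by simp
    then show "((\<lambda>a. c * a ^ Suc n / Suc n) has_vector_derivative c * x ^ n) (at x within {0..t})"
      by (simp add: has_real_derivative_iff_has_vector_derivative del: of_nat_Suc)
  qed
  have "norm (integral {0..t} g) \<le> integral {0..t} (\<lambda>\<tau>. c * \<tau> ^ n)"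
    by (rule integral_norm_bound_integral)
      (use assms hi in \<open>auto intro!: integrable_continuous_interval continuous_intros intro: continuous_on_subset[OF g]\<close>)
  with integral_unique[OF hi] show ?thesis by simp
qed

lemma power_fact_tendsto_0: "(\<lambda>n. c * x ^ n / fact n) \<longlonglongrightarrow> (0::real)"
proof -
  have "summable (\<lambda>n. x ^ n / fact n)"
    using summable_exp[of x] by (simp add: divide_inverse mult.commute)
  from tendsto_mult_right_zero[OF summable_LIMSEQ_zero[OF this], of c] show ?thesis by simp
qed

text \<open>A Gronwall argument by iteration: \<open>y\<close> is the integral of \<open>d\<close>
  and \<open>d\<close> is controlled by \<open>y\<close>, so each integration raises the power of
  \<open>t\<close> in the bound by one and the factorials force the value 0 in the limit.\<close>

lemma zero_if_norm_deriv_le: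
  fixes y :: "real \<Rightarrow> 'a::banach"
  assumes "y 0 = 0" "0 \<le> T"
    and dy: "\<And>t. 0 \<le> t \<Longrightarrow> t \<le> T \<Longrightarrow> (y has_vector_derivative d t) (at t within {0..})"
    and d: "continuous_on {0..T} d"
    and le: "\<And>t. 0 \<le> t \<Longrightarrow> t \<le> T \<Longrightarrow> norm (d t) \<le> M * norm (y t)"
  shows "y T = 0"
proof -
  have "continuous_on {0..T} y"
    by (rule continuous_on_vector_derivative[where f' = d])
      (auto intro: has_vector_derivative_within_subset[OF dy])
  then have "compact (y ` {0..T})"
    by (intro compact_continuous_image) auto
  then obtain S where S: "\<And>t. 0 \<le> t \<Longrightarrow> t \<le> T \<Longrightarrow> norm (y t) \<le> S"
    by (meson atLeastAtMost_iff compact_imp_bounded bounded_iff imageI)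
  have yd: "y t = integral {0..t} d" if "0 \<le> t" "t \<le> T" for t
  proof -
    have "(d has_integral y t - y 0) {0..t}"
      by (rule fundamental_theorem_of_calculus)
        (use that in \<open>auto intro!: dy[THEN has_vector_derivative_within_subset]\<close>)
    with assms(1) show ?thesis by (simp add: integral_unique)
  qed
  \<comment> \<open>\<open>M\<close> carries no sign, but the induction multiplies inequalities by
    it, so a negative value is replaced by 0.\<close>
  define M' where "M' = max M 0"
  have le': "norm (d t) \<le> M' * norm (y t)" if "0 \<le> t" "t \<le> T" for t
    using le[OF that] mult_right_mono[of M M' "norm (y t)"] by (simp add: M'_def)
  have "norm (y t) \<le> S * M' ^ n / fact n * t ^ n" if "0 \<le> t" "t \<le> T" for t n
    using that
  proof (induction n arbitrary: t)
    case 0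
    then show ?case using S by simp
  next
    case (Suc n)
    have "norm (integral {0..t} d) \<le> S * M' ^ Suc n / fact n * t ^ Suc n / Suc n"
    proof (rule power_bound_integral[OF Suc.prems d])
      fix \<tau> assume \<tau>: "0 \<le> \<tau>" "\<tau> \<le> T"
      have "norm (d \<tau>) \<le> M' * (S * M' ^ n / fact n * \<tau> ^ n)"
        using le'[OF \<tau>] mult_left_mono[OF Suc.IH[OF \<tau>], of M'] by (simp add: M'_def)
      then show "norm (d \<tau>) \<le> S * M' ^ Suc n / fact n * \<tau> ^ n"
        by (simp add: mult_ac)
    qed
    then show ?case
      using yd[OF Suc.prems] by (simp add: field_simps)
  qed
  from this[OF \<open>0 \<le> T\<close> order_refl] have "norm (y T) \<le> S * (M' * T) ^ n / fact n" for n
    by (simp add: power_mult_distrib mult.assoc)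
  then have "norm (y T) \<le> 0"
    using LIMSEQ_le_const[OF power_fact_tendsto_0[of S "M' * T"]] by blast
  then show ?thesis by simp
qed

text \<open>These are the increments of the Picard iteration, not the iterates: by linearity the
  iterates are the partial sums, and the solution is the series over \<open>n\<close>.\<close>

primrec picard :: "(real \<Rightarrow> 'a::banach \<Rightarrow> 'a) \<Rightarrow> 'a \<Rightarrow> nat \<Rightarrow> real \<Rightarrow> 'a" where
  "picard L y0 0 t = y0"
| "picard L y0 (Suc n) t = integral {0..t} (\<lambda>\<tau>. L \<tau> (picard L y0 n \<tau>))"

text \<open>On each \<open>{0..T}\<close> the Picard series is dominated by an exponential series
  and may be differentiated term by term. A general bilinear product covers composition with the
  coefficient on either side, as needed for a fundamental solution and its inverse.\<close>

lemma linear_ode_exists: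
  fixes prod :: "'c::real_normed_vector \<Rightarrow> 'a::banach \<Rightarrow> 'a"
  assumes "bounded_bilinear prod" and C: "continuous_on {0..} C"
  shows "\<exists>y. y 0 = y0 \<and> (\<forall>t\<ge>0. (y has_vector_derivative prod (C t) (y t)) (at t within {0..}))"
proof -
  interpret bounded_bilinear prod by fact
  define f where "f = picard (\<lambda>t. prod (C t)) y0"
  \<comment> \<open>The derivative of \<open>f n\<close>: differentiation kills the constant term
    and turns every later term into its predecessor multiplied by \<open>C t\<close>, whence the
    index shift.\<close>
  define f' where "f' n t = (case n of 0 \<Rightarrow> 0 | Suc k \<Rightarrow> prod (C t) (f k t))" for n t
  have f_0 [simp]: "f 0 t = y0" and f_Suc [simp]: "f (Suc n) t = integral {0..t} (\<lambda>\<tau>. prod (C \<tau>) (f n \<tau>))" for n t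
    by (simp_all add: f_def)
  have C': "continuous_on {0..T} C" for T
    by (rule continuous_on_subset[OF C]) auto
  have cont_f: "continuous_on {0..T} (f n)" for n T
  proof (induction n)
    case (Suc n)
    then have "(\<lambda>\<tau>. prod (C \<tau>) (f n \<tau>)) integrable_on {0..T}"
      by (intro integrable_continuous_interval continuous_on C')
    from indefinite_integral_continuous_1[OF this] show ?case by simp
  qed (simp add: f_def)
  have cont_Cf: "continuous_on {0..T} (\<lambda>\<tau>. prod (C \<tau>) (f n \<tau>))" for n T
    by (intro continuous_on C' cont_f)
  have df: "(f n has_vector_derivative f' n t) (at t within {0..T})" if "t \<in> {0..T}" for n t T
  proof (cases n)
    case 0
    have "f 0 = (\<lambda>_. y0)" by (simp add: fun_eq_iff)
    with 0 show ?thesis by (simp add: f'_def)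
  next
    case (Suc k)
    have "f (Suc k) = (\<lambda>t. integral {0..t} (\<lambda>\<tau>. prod (C \<tau>) (f k \<tau>)))" by (simp add: fun_eq_iff)
    with Suc integral_has_vector_derivative[OF cont_Cf that] show ?thesis
      by (simp add: f'_def)
  qed
  obtain Kp where Kp: "0 < Kp" "\<And>a b. norm (prod a b) \<le> norm a * norm b * Kp"
    using pos_bounded by blast
  define y where "y t = (\<Sum>n. f n t)" for t
  have main: "(y has_vector_derivative prod (C t) (y t)) (at t within {0..T})"
    if t: "t \<in> {0..T}" for t T
  proof -
    have "compact (C ` {0..T})"
      by (intro compact_continuous_image C') auto
    then obtain M where M: "\<And>t. 0 \<le> t \<Longrightarrow> t \<le> T \<Longrightarrow> norm (C t) \<le> M"
      by (meson atLeastAtMost_iff compact_imp_bounded bounded_iff imageI)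
    define M' where "M' = max M 0 * Kp"
    have M': "0 \<le> M'" using Kp by (simp add: M'_def)
    have CM: "norm (prod (C t) b) \<le> M' * norm b" if "0 \<le> t" "t \<le> T" for t b
    proof -
      have "norm (C t) * norm b * Kp \<le> max M 0 * norm b * Kp"
        using M[OF that] Kp(1) by (intro mult_right_mono) auto
      with Kp(2)[of "C t" b] show ?thesis by (simp add: M'_def mult_ac)
    qed
    have bd: "norm (f n t) \<le> norm y0 * M' ^ n / fact n * t ^ n" if "0 \<le> t" "t \<le> T" for t n
      using that
    proof (induction n arbitrary: t)
      case (Suc n)
      have "norm (integral {0..t} (\<lambda>\<tau>. prod (C \<tau>) (f n \<tau>))) \<le> norm y0 * M' ^ Suc n / fact n * t ^ Suc n / Suc n"
      proof (rule power_bound_integral[OF Suc.prems cont_Cf])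
        fix \<tau> assume \<tau>: "0 \<le> \<tau>" "\<tau> \<le> T"
        have "norm (prod (C \<tau>) (f n \<tau>)) \<le> M' * (norm y0 * M' ^ n / fact n * \<tau> ^ n)"
          using CM[OF \<tau>, of "f n \<tau>"] mult_left_mono[OF Suc.IH[OF \<tau>] M'] by linarith
        then show "norm (prod (C \<tau>) (f n \<tau>)) \<le> norm y0 * M' ^ Suc n / fact n * \<tau> ^ n"
          by (simp add: mult_ac)
      qed
      then show ?case by (simp add: field_simps)
    qed simp
    define S where "S n = norm y0 * ((M' * T) ^ n / fact n)" for n
    have bdS: "norm (f n t) \<le> S n" if "0 \<le> t" "t \<le> T" for t n
    proof -
      have "norm (f n t) \<le> norm y0 * M' ^ n / fact n * t ^ n" by (rule bd[OF that])
      also have "\<dots> \<le> norm y0 * M' ^ n / fact n * T ^ n"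
        using that M' by (intro mult_left_mono power_mono) auto
      finally show ?thesis by (simp add: S_def power_mult_distrib)
    qed
    have sS: "summable S"
      unfolding S_def using summable_exp[of "M' * T"]
      by (intro summable_mult) (simp add: divide_inverse mult.commute)
    have sf: "summable (\<lambda>n. f n t)" if "0 \<le> t" "t \<le> T" for t
      by (rule summable_comparison_test'[OF sS]) (use bdS that in auto)
    have sf': "(\<lambda>n. f' n t) sums prod (C t) (y t)" if "0 \<le> t" "t \<le> T" for t
    proof -
      have "(\<lambda>n. prod (C t) (f n t)) sums prod (C t) (y t)"
        unfolding y_def by (rule bounded_linear.sums[OF bounded_linear_right summable_sums[OF sf[OF that]]])
      then have "(\<lambda>n. f' (Suc n) t) sums prod (C t) (y t)" by (simp add: f'_def)
      then show ?thesis by (subst (asm) sums_Suc_iff) (simp add: f'_def)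
    qed
    \<comment> \<open>Termwise differentiation needs uniform convergence of the derivatives. They
      are dominated by \<open>M' * S k\<close>, with the same index shift.\<close>
    have "uniform_limit {0..T} (\<lambda>n x. \<Sum>i<n. f' i x) (\<lambda>x. \<Sum>i. f' i x) sequentially"
    proof (rule Weierstrass_m_test)
      show "norm (f' n x) \<le> (case n of 0 \<Rightarrow> 0 | Suc k \<Rightarrow> M' * S k)" if "x \<in> {0..T}" for n x
      proof (cases n)
        case (Suc k)
        have "norm (prod (C x) (f k x)) \<le> M' * S k"
          using CM[of x "f k x"] mult_left_mono[OF bdS[of x k] M'] that by (auto intro: order_trans)
        with Suc show ?thesis by (simp add: f'_def)
      qed (simp add: f'_def)
      show "summable (\<lambda>n. case n of 0 \<Rightarrow> 0 | Suc k \<Rightarrow> M' * S k)"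
        by (subst summable_Suc_iff[symmetric]) (simp add: summable_mult sS)
    qed
    then have ul: "uniform_limit {0..T} (\<lambda>n x. \<Sum>i<n. f' i x) (\<lambda>x. prod (C x) (y x)) sequentially"
      using sf' by (subst (asm) uniform_limit_cong'[where g = "\<lambda>n x. \<Sum>i<n. f' i x" and i = "\<lambda>x. prod (C x) (y x)"])
        (auto simp: sums_iff)
    have "\<exists>g. \<forall>x\<in>{0..T}. (\<lambda>n. f n x) sums g x \<and> (g has_derivative (\<lambda>h. h *\<^sub>R prod (C x) (y x))) (at x within {0..T})"
    proof (rule has_derivative_series)
      show "(f n has_derivative (\<lambda>h. h *\<^sub>R f' n x)) (at x within {0..T})" if "x \<in> {0..T}" for n x
        using df[OF that] by (simp add: has_vector_derivative_def)
      show "(\<lambda>n. f n t) sums y t" unfolding y_def by (rule summable_sums[OF sf]) (use t in auto)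
      show "\<forall>\<^sub>F n in sequentially. \<forall>x\<in>{0..T}. \<forall>h. norm ((\<Sum>i<n. h *\<^sub>R f' i x) - h *\<^sub>R prod (C x) (y x)) \<le> e * norm h"
        if "e > 0" for e
        using uniform_limitD[OF ul that]
      proof eventually_elim
        case (elim n)
        show ?case
        proof safe
          fix x h assume "x \<in> {0..T}"
          then have "norm ((\<Sum>i<n. f' i x) - prod (C x) (y x)) \<le> e"
            using elim by (force simp: dist_norm)
          from mult_right_mono[OF this abs_ge_zero[of h]]
          have "norm (h *\<^sub>R ((\<Sum>i<n. f' i x) - prod (C x) (y x))) \<le> e * norm h"
            by (simp add: mult.commute)
          then show "norm ((\<Sum>i<n. h *\<^sub>R f' i x) - h *\<^sub>R prod (C x) (y x)) \<le> e * norm h"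
            by (simp add: scaleR_diff_right scaleR_sum_right)
        qed
      qed
    qed (use t in auto)
    then obtain g where g: "\<And>x. x \<in> {0..T} \<Longrightarrow> (\<lambda>n. f n x) sums g x"
      and dg: "\<And>x. x \<in> {0..T} \<Longrightarrow> (g has_vector_derivative prod (C x) (y x)) (at x within {0..T})"
      unfolding has_vector_derivative_def by blast
    have "y x = g x" if "x \<in> {0..T}" for x
      unfolding y_def using g[OF that] by (simp add: sums_iff)
    then show ?thesis
      using has_vector_derivative_transform[OF t _ dg[OF t], of y] by simp
  qed
  have "(y has_vector_derivative prod (C t) (y t)) (at t within {0..})" if "t \<ge> 0" for t
  proof -
    \<comment> \<open>The series \<open>y\<close> was defined without reference to \<open>T\<close>,
      so \<open>T = t + 1\<close> may be chosen separately for each \<open>t\<close>; near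
      \<open>t\<close> the interval and the half-line agree.\<close>
    have "at t within {0..} = at t within {0..t+1}"
      by (rule at_within_nhd[of _ "{..<t+1}"]) auto
    then show ?thesis using main[of t "t+1"] that by simp
  qed
  moreover have "y 0 = y0"
  proof -
    \<comment> \<open>At 0 all integrals run over a single point, so only the term with index 0
      survives.\<close>
    have "(\<lambda>n. f n 0) = (\<lambda>n. if n = 0 then y0 else 0)"
    proof
      fix n show "f n 0 = (if n = 0 then y0 else 0)" by (cases n) auto
    qed
    then show ?thesis unfolding y_def using sums_single[of 0 "\<lambda>_. y0"] by (simp add: sums_iff)
  qed
  ultimately show ?thesis by blast
qed

section \<open>Fundamental solutions, their inverses and uniqueness\<close>

definition fundamental_solution ::
    "(real \<Rightarrow> 'z::banach \<Rightarrow>\<^sub>L 'z) \<Rightarrow> (real \<Rightarrow> 'z \<Rightarrow>\<^sub>L 'z) \<Rightarrow> (real \<Rightarrow> 'z \<Rightarrow>\<^sub>L 'z) \<Rightarrow> bool" where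
  "fundamental_solution C \<Phi> \<Psi> \<longleftrightarrow>
     \<Phi> 0 = id_blinfun \<and>
     (\<forall>t\<ge>0. \<Phi> t o\<^sub>L \<Psi> t = id_blinfun \<and> \<Psi> t o\<^sub>L \<Phi> t = id_blinfun \<and>
        (\<Phi> has_vector_derivative (C t o\<^sub>L \<Phi> t)) (at t within {0..}) \<and>
        (\<Psi> has_vector_derivative - (\<Psi> t o\<^sub>L C t)) (at t within {0..}))"

lemma blinfun_compose_id [simp]: "f o\<^sub>L id_blinfun = f" "id_blinfun o\<^sub>L f = f"
  by (auto intro!: blinfun_eqI)

lemmas blinfun_compose_has_vector_derivative [derivative_intros] =
  bounded_bilinear.has_vector_derivative[OF bounded_bilinear_blinfun_compose]

lemmas blinfun_apply_has_vector_derivative =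
  bounded_bilinear.has_vector_derivative[OF bounded_bilinear_blinfun_apply]

lemma blinfun_compose_assoc: "(f o\<^sub>L g) o\<^sub>L h = f o\<^sub>L (g o\<^sub>L h)"
  by (auto intro!: blinfun_eqI)

lemmas blinfun_compose_diff_left = bounded_bilinear.diff_left[OF bounded_bilinear_blinfun_compose]
  and blinfun_compose_diff_right = bounded_bilinear.diff_right[OF bounded_bilinear_blinfun_compose]
  and blinfun_compose_uminus_left = bounded_bilinear.minus_left[OF bounded_bilinear_blinfun_compose]
  and blinfun_compose_uminus_right = bounded_bilinear.minus_right[OF bounded_bilinear_blinfun_compose]

text \<open>No operator is inverted: \<Psi> is obtained as the solution of its own equation
  \<open>\<Psi>' = - \<Psi> C\<close> and is then shown to be the inverse. One composition,
  \<open>\<Psi> \<Phi>\<close>, is constant because its derivative cancels.\<close>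

lemma fundamental_solution_exists:
  fixes C :: "real \<Rightarrow> 'z::banach \<Rightarrow>\<^sub>L 'z"
  assumes C: "continuous_on {0..} C"
  shows "\<exists>\<Phi> \<Psi>. fundamental_solution C \<Phi> \<Psi>"
proof -
  obtain \<Phi> where \<Phi>0: "\<Phi> 0 = id_blinfun"
    and d\<Phi>: "\<And>t. t \<ge> 0 \<Longrightarrow> (\<Phi> has_vector_derivative (C t o\<^sub>L \<Phi> t)) (at t within {0..})"
    using linear_ode_exists[OF bounded_bilinear_blinfun_compose C, of id_blinfun] by blast
  obtain \<Psi> where \<Psi>0: "\<Psi> 0 = id_blinfun"
    and "\<And>t. t \<ge> 0 \<Longrightarrow> (\<Psi> has_vector_derivative (\<Psi> t o\<^sub>L - C t)) (at t within {0..})"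
    using linear_ode_exists[OF bounded_bilinear.flip[OF bounded_bilinear_blinfun_compose]
        continuous_on_minus[OF C], of id_blinfun] by blast
  then have d\<Psi>: "(\<Psi> has_vector_derivative - (\<Psi> t o\<^sub>L C t)) (at t within {0..})" if "t \<ge> 0" for t
    using that by (simp add: blinfun_compose_uminus_right)
  have c: "continuous_on {0..} \<Phi>" "continuous_on {0..} \<Psi>"
    by (rule continuous_on_vector_derivative, rule d\<Phi> d\<Psi>, simp)+
  have 1: "(\<Psi> t o\<^sub>L \<Phi> t) - id_blinfun = 0" if "t \<ge> 0" for t
  proof (rule zero_if_norm_deriv_le[where y = "\<lambda>t. (\<Psi> t o\<^sub>L \<Phi> t) - id_blinfun" and d = "\<lambda>t. 0" and M = 0])
    show "((\<lambda>t. (\<Psi> t o\<^sub>L \<Phi> t) - id_blinfun) has_vector_derivative 0) (at s within {0..})" if "0 \<le> s" for s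
      using has_vector_derivative_diff[OF blinfun_compose_has_vector_derivative[OF d\<Psi> d\<Phi>]
          has_vector_derivative_const[of "id_blinfun :: 'z \<Rightarrow>\<^sub>L 'z"], OF that that]
      by (simp add: blinfun_compose_assoc blinfun_compose_uminus_left)
  qed (use that in \<open>simp_all add: \<Phi>0 \<Psi>0\<close>)
  \<comment> \<open>In infinite dimension a left inverse need not be a right inverse. The defect
    \<open>W\<close> of the other composition satisfies \<open>W' = C W - W C\<close> and
    \<open>W 0 = 0\<close>, so the Gronwall argument applies with constant
    \<open>2 * M\<close>.\<close>
  have 2: "(\<Phi> t o\<^sub>L \<Psi> t) - id_blinfun = 0" if t: "t \<ge> 0" for t
  proof -
    have "compact (C ` {0..t})"
      by (intro compact_continuous_image continuous_on_subset[OF C]) auto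
    then obtain M where M: "\<And>s. 0 \<le> s \<Longrightarrow> s \<le> t \<Longrightarrow> norm (C s) \<le> M"
      by (meson atLeastAtMost_iff compact_imp_bounded bounded_iff imageI)
    let ?W = "\<lambda>t. (\<Phi> t o\<^sub>L \<Psi> t) - id_blinfun"
    let ?d = "\<lambda>t. (C t o\<^sub>L ?W t) - (?W t o\<^sub>L C t)"
    show ?thesis
    proof (rule zero_if_norm_deriv_le[where y = ?W and d = ?d and M = "2 * M"])
      fix s assume s: "0 \<le> s" "s \<le> t"
      show "(?W has_vector_derivative ?d s) (at s within {0..})"
        using s by (auto intro!: derivative_eq_intros d\<Phi> d\<Psi>
            simp: blinfun_compose_assoc blinfun_compose_diff_right blinfun_compose_diff_left blinfun_compose_uminus_right)
      have "norm (?d s) \<le> norm (C s) * norm (?W s) + norm (?W s) * norm (C s)"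
        by (rule norm_triangle_le_diff) (intro add_mono norm_blinfun_compose)
      also have "\<dots> \<le> M * norm (?W s) + norm (?W s) * M"
        by (intro add_mono mult_right_mono mult_left_mono M s norm_ge_zero)
      finally show "norm (?d s) \<le> 2 * M * norm (?W s)" by (simp add: mult.commute)
    next
      show "continuous_on {0..t} ?d"
        by (intro continuous_intros bounded_bilinear.continuous_on[OF bounded_bilinear_blinfun_compose]
            c[THEN continuous_on_subset] C[THEN continuous_on_subset]) auto
    qed (use t in \<open>simp_all add: \<Phi>0 \<Psi>0\<close>)
  qed
  have "\<Phi> t o\<^sub>L \<Psi> t = id_blinfun \<and> \<Psi> t o\<^sub>L \<Phi> t = id_blinfun" if "t \<ge> 0" for t
    using 1[OF that] 2[OF that] by (simp only: right_minus_eq)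
  with \<Phi>0 d\<Phi> d\<Psi> have "fundamental_solution C \<Phi> \<Psi>"
    unfolding fundamental_solution_def by blast
  then show ?thesis by blast
qed

context
  fixes C \<Phi> \<Psi> :: "real \<Rightarrow> 'z::banach \<Rightarrow>\<^sub>L 'z"
  assumes FS: "fundamental_solution C \<Phi> \<Psi>"
begin

lemma
  shows fundamental_solution_0: "\<Phi> 0 = id_blinfun"
    and fundamental_solution_inverse:
      "t \<ge> 0 \<Longrightarrow> \<Phi> t o\<^sub>L \<Psi> t = id_blinfun" "t \<ge> 0 \<Longrightarrow> \<Psi> t o\<^sub>L \<Phi> t = id_blinfun"
    and fundamental_solution_deriv:
      "t \<ge> 0 \<Longrightarrow> (\<Phi> has_vector_derivative (C t o\<^sub>L \<Phi> t)) (at t within {0..})"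
      "t \<ge> 0 \<Longrightarrow> (\<Psi> has_vector_derivative - (\<Psi> t o\<^sub>L C t)) (at t within {0..})"
  using FS by (auto simp: fundamental_solution_def)

lemma fundamental_solution_inverse_0: "\<Psi> 0 = id_blinfun"
  using fundamental_solution_inverse(1)[of 0] by (simp add: fundamental_solution_0)

lemma fundamental_solution_continuous:
  "continuous_on {0..} \<Phi>" "continuous_on {0..} \<Psi>"
  by (rule continuous_on_vector_derivative, rule fundamental_solution_deriv, simp)+

lemma fundamental_solution_inverse_apply:
  "t \<ge> 0 \<Longrightarrow> \<Phi> t (\<Psi> t v) = v" "t \<ge> 0 \<Longrightarrow> \<Psi> t (\<Phi> t v) = v"
  using fundamental_solution_inverse[of t] by (simp_all flip: blinfun_apply_blinfun_compose)

text \<open>The derivative is not required at \<open>0\<close>, where a conformable solution need not have one.\<close>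

lemma fundamental_solution_unique:
  assumes y: "continuous_on {0..} y"
    and dy: "\<And>t. t > 0 \<Longrightarrow> (y has_vector_derivative C t (y t)) (at t)"
    and t: "t \<ge> 0"
  shows "y t = \<Phi> t (y 0)"
proof -
  \<comment> \<open>The function \<open>\<Psi> s (y s)\<close> is constant: its derivative cancels
    away from 0, and a continuous function may have one exceptional point.\<close>
  have 1: "continuous_on {0..t} (\<lambda>s. \<Psi> s (y s))"
    by (intro continuous_intros continuous_on_subset[OF y]
        continuous_on_subset[OF fundamental_solution_continuous(2)]) auto
  have 2: "((\<lambda>s. \<Psi> s (y s)) has_derivative (\<lambda>h. 0)) (at s within {0..t})"
    if s: "s \<in> {0..t} - {0}" for s
  proof -
    have "(\<Psi> has_vector_derivative - (\<Psi> s o\<^sub>L C s)) (at s within {0..t})"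
      using s by (intro has_vector_derivative_within_subset[OF fundamental_solution_deriv(2)]) auto
    from blinfun_apply_has_vector_derivative[OF this has_vector_derivative_at_within[OF dy[of s]]] s
    show ?thesis
      by (simp add: blinfun.minus_left has_vector_derivative_def)
  qed
  have "\<Psi> t (y t) = \<Psi> 0 (y 0)"
    by (rule has_derivative_zero_unique_strong_interval[of "{0}", OF _ 1 refl 2]) (use t in auto)
  with fundamental_solution_inverse_apply(1)[OF t, of "y t"] show ?thesis
    by (simp add: fundamental_solution_inverse_0)
qed

end

section \<open>Conformable equations and the change of time\<close>

definition conf_time :: "real \<Rightarrow> real \<Rightarrow> real" where
  "conf_time \<alpha> t = t powr \<alpha> / \<alpha>"

definition conf_clock :: "real \<Rightarrow> real \<Rightarrow> real" where
  "conf_clock \<alpha> \<tau> = (\<alpha> * \<tau>) powr (1 / \<alpha>)"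

lemma has_vector_derivative_iff_quotient:
  "(f has_vector_derivative D) (at x) \<longleftrightarrow> ((\<lambda>h. (f (x + h) - f x) /\<^sub>R h) \<longlongrightarrow> D) (at 0)"
proof -
  have "norm (f (x + h) - f x - h *\<^sub>R D) / norm h = norm ((f (x + h) - f x) /\<^sub>R h - D)" if "h \<noteq> 0" for h
  proof -
    have "(f (x + h) - f x) /\<^sub>R h - D = (f (x + h) - f x - h *\<^sub>R D) /\<^sub>R h"
      using that by (simp add: scaleR_diff_right)
    then show ?thesis by (simp add: divide_inverse mult.commute)
  qed
  then have "((\<lambda>h. norm (f (x + h) - f x - h *\<^sub>R D) / norm h) \<longlongrightarrow> 0) (at 0) \<longleftrightarrow>
      ((\<lambda>h. norm ((f (x + h) - f x) /\<^sub>R h - D)) \<longlongrightarrow> 0) (at 0)"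
    by (intro Lim_cong_within) auto
  then show ?thesis
    by (simp add: has_vector_derivative_def has_derivative_at bounded_linear_scaleR_left
        tendsto_norm_zero_iff LIM_zero_iff)
qed

context
  fixes \<alpha> :: real
  assumes \<alpha>: "0 < \<alpha>" "\<alpha> \<le> 1"
begin

lemma conf_time_nonneg: "0 \<le> conf_time \<alpha> t"
  and conf_time_pos: "0 < t \<Longrightarrow> 0 < conf_time \<alpha> t"
  and conf_clock_nonneg: "0 \<le> conf_clock \<alpha> \<tau>"
  and conf_clock_pos: "0 < \<tau> \<Longrightarrow> 0 < conf_clock \<alpha> \<tau>"
  and conf_clock_0: "conf_clock \<alpha> 0 = 0"
  using \<alpha> by (auto simp: conf_time_def conf_clock_def)

lemma conf_time_mono: "0 \<le> s \<Longrightarrow> s \<le> t \<Longrightarrow> conf_time \<alpha> s \<le> conf_time \<alpha> t"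
  using \<alpha> by (auto simp: conf_time_def intro!: divide_right_mono powr_mono2)

lemma conf_clock_mono: "0 \<le> \<sigma> \<Longrightarrow> \<sigma> \<le> \<tau> \<Longrightarrow> conf_clock \<alpha> \<sigma> \<le> conf_clock \<alpha> \<tau>"
  using \<alpha> by (auto simp: conf_clock_def intro!: powr_mono2)

lemma conf_clock_time: "0 \<le> t \<Longrightarrow> conf_clock \<alpha> (conf_time \<alpha> t) = t"
  and conf_time_clock: "0 \<le> \<tau> \<Longrightarrow> conf_time \<alpha> (conf_clock \<alpha> \<tau>) = \<tau>"
  using \<alpha> by (auto simp: conf_time_def conf_clock_def powr_powr)

lemma continuous_on_conf_time: "continuous_on {0..} (conf_time \<alpha>)"
  unfolding conf_time_def using \<alpha> by (intro continuous_intros continuous_on_powr') auto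

lemma continuous_on_conf_clock: "continuous_on {0..} (conf_clock \<alpha>)"
  unfolding conf_clock_def using \<alpha> by (intro continuous_intros continuous_on_powr') auto

lemma conf_exp_eq: "conf_exp \<alpha> \<mu> t = exp (\<mu> * conf_time \<alpha> t)"
  by (simp add: conf_exp_def conf_time_def)

lemma conf_time_deriv:
  assumes "0 < t"
  shows "(conf_time \<alpha> has_real_derivative t powr (\<alpha> - 1)) (at t)"
  unfolding conf_time_def using assms \<alpha> by (auto intro!: derivative_eq_intros)

text \<open>The derivative is expressed through the value of the clock, so that the chain rule
  cancels it against the weight \<open>t powr (\<alpha> - 1)\<close> of the conformable
  equation.\<close>

lemma conf_clock_deriv:
  assumes "0 < \<tau>"
  shows "(conf_clock \<alpha> has_real_derivative conf_clock \<alpha> \<tau> powr (1 - \<alpha>)) (at \<tau>)"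
proof -
  have "((\<lambda>\<tau>. (\<alpha> * \<tau>) powr (1 / \<alpha>)) has_real_derivative (\<alpha> * \<tau>) powr (1 / \<alpha> - 1)) (at \<tau>)"
    using assms \<alpha> by (auto intro!: derivative_eq_intros)
  moreover have "(\<alpha> * \<tau>) powr (1 / \<alpha> - 1) = conf_clock \<alpha> \<tau> powr (1 - \<alpha>)"
    using \<alpha> by (simp add: conf_clock_def powr_powr field_simps)
  ultimately show ?thesis by (simp add: conf_clock_def[abs_def])
qed

text \<open>For fixed \<open>t\<close> the increment is \<open>h * c\<close> with a positive
  constant \<open>c\<close>, so the conformable quotient is the ordinary one after an affine
  substitution.\<close>

lemma has_conf_deriv_nz_iff:
  assumes "0 < t"
  shows "has_conf_deriv_nz \<alpha> g D t \<longleftrightarrow> (g has_vector_derivative t powr (\<alpha> - 1) *\<^sub>R D) (at t)"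
proof -
  define c where "c = t powr (1 - \<alpha>)"
  have c: "c > 0" "t powr (\<alpha> - 1) = inverse c"
    using assms by (simp_all add: c_def flip: powr_minus)
  have "has_conf_deriv_nz \<alpha> g D t \<longleftrightarrow> ((\<lambda>h. g (t + h * c)) has_vector_derivative D) (at 0)"
    using assms by (simp add: has_conf_deriv_nz_def c_def has_vector_derivative_iff_quotient)
  also have "\<dots> \<longleftrightarrow> (g has_vector_derivative inverse c *\<^sub>R D) (at t)"
  proof
    assume "((\<lambda>h. g (t + h * c)) has_vector_derivative D) (at 0)"
    then have D: "((\<lambda>h. g (t + h * c)) has_vector_derivative D) (at ((t - t) / c))" by simp
    have "((\<lambda>y. (y - t) / c) has_vector_derivative inverse c) (at t)"
      using c by (auto intro!: derivative_eq_intros simp: divide_inverse simp flip: has_real_derivative_iff_has_vector_derivative)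
    from vector_diff_chain_at[OF this D] c show "(g has_vector_derivative inverse c *\<^sub>R D) (at t)"
      by (simp add: o_def)
  next
    assume "(g has_vector_derivative inverse c *\<^sub>R D) (at t)"
    then have D: "(g has_vector_derivative inverse c *\<^sub>R D) (at (t + 0 * c))" by simp
    have "((\<lambda>h. t + h * c) has_vector_derivative c) (at 0)"
      by (auto intro!: derivative_eq_intros simp flip: has_real_derivative_iff_has_vector_derivative)
    from vector_diff_chain_at[OF this D] c show "((\<lambda>h. g (t + h * c)) has_vector_derivative D) (at 0)"
      by (simp add: o_def)
  qed
  finally show ?thesis using c by simp
qed

text \<open>The condition at 0 is automatic: by the equation the derivatives at \<open>t > 0\<close>
  are \<open>C t (x t)\<close>, and these converge to \<open>C 0 (x 0)\<close> by continuity. Hence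
  the equation matters only on the open half-line.\<close>

lemma conf_solution_iff:
  assumes C: "continuous_on {0..} C"
  shows "conf_solution \<alpha> C x \<longleftrightarrow> continuous_on {0..} x \<and>
    (\<forall>t>0. (x has_vector_derivative t powr (\<alpha> - 1) *\<^sub>R C t (x t)) (at t))" (is "_ \<longleftrightarrow> ?R")
proof
  assume "conf_solution \<alpha> C x"
  then show ?R
    by (auto simp: conf_solution_def has_conf_deriv_def simp flip: has_conf_deriv_nz_iff)
next
  assume R: ?R
  then have nz: "has_conf_deriv_nz \<alpha> x (C t (x t)) t" if "t > 0" for t
    using that has_conf_deriv_nz_iff by blast
  have "((\<lambda>t. C t (x t)) \<longlongrightarrow> C 0 (x 0)) (at_right 0)"
  proof -
    have "continuous_on {0..} (\<lambda>t. C t (x t))"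
      using C R by (intro continuous_intros) auto
    then have "((\<lambda>t. C t (x t)) \<longlongrightarrow> C 0 (x 0)) (at 0 within {0..})"
      by (simp add: continuous_on_def)
    then show ?thesis by (rule tendsto_within_subset) auto
  qed
  moreover have "\<forall>\<^sub>F r in at_right 0. has_conf_deriv_nz \<alpha> x (C r (x r)) r"
    using eventually_at_right_less[of "0 :: real"] by eventually_elim (rule nz)
  ultimately have "\<exists>d. (\<forall>\<^sub>F r in at_right 0. has_conf_deriv_nz \<alpha> x (d r) r) \<and> (d \<longlongrightarrow> C 0 (x 0)) (at_right 0)"
    by (intro exI[of _ "\<lambda>t. C t (x t)"] conjI)
  with nz R show "conf_solution \<alpha> C x"
    by (auto simp: conf_solution_def has_conf_deriv_def)
qed

context
  fixes C \<Phi> \<Psi> :: "real \<Rightarrow> 'z::banach \<Rightarrow>\<^sub>L 'z"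
  assumes C: "continuous_on {0..} C"
    and FS: "fundamental_solution (\<lambda>\<tau>. C (conf_clock \<alpha> \<tau>)) \<Phi> \<Psi>"
begin

lemma conf_solution_fundamental: "conf_solution \<alpha> C (\<lambda>t. \<Phi> (conf_time \<alpha> t) v)"
  unfolding conf_solution_iff[OF C]
proof (intro conjI allI impI)
  show "continuous_on {0..} (\<lambda>t. \<Phi> (conf_time \<alpha> t) v)"
    by (rule blinfun.continuous_on[OF continuous_on_compose2[OF fundamental_solution_continuous(1)[OF FS]
            continuous_on_conf_time] continuous_on_const]) (auto simp: conf_time_nonneg)
next
  fix t :: real assume t: "t > 0"
  have "at (conf_time \<alpha> t) within {0..} = at (conf_time \<alpha> t)"
    by (intro at_within_interior) (simp add: conf_time_pos t)
  with fundamental_solution_deriv(1)[OF FS conf_time_nonneg[of t]]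
  have "(\<Phi> has_vector_derivative (C t o\<^sub>L \<Phi> (conf_time \<alpha> t))) (at (conf_time \<alpha> t))"
    using t by (simp add: conf_clock_time)
  from blinfun_apply_has_vector_derivative[OF this has_vector_derivative_const, of v]
  have "((\<lambda>\<tau>. \<Phi> \<tau> v) has_vector_derivative C t (\<Phi> (conf_time \<alpha> t) v)) (at (conf_time \<alpha> t))"
    by simp
  from vector_diff_chain_at[OF conf_time_deriv[OF t, unfolded has_real_derivative_iff_has_vector_derivative] this]
  show "((\<lambda>t. \<Phi> (conf_time \<alpha> t) v) has_vector_derivative
      t powr (\<alpha> - 1) *\<^sub>R C t (\<Phi> (conf_time \<alpha> t) v)) (at t)"
    by (simp add: o_def)
qed

text \<open>Composed with the clock, a conformable solution solves the ordinary equation for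
  positive times and is continuous at 0, which is exactly what
  \<open>fundamental_solution_unique\<close> accepts.\<close>

lemma conf_solution_eq_fundamental:
  assumes x: "conf_solution \<alpha> C x" and t: "t \<ge> 0"
  shows "x t = \<Phi> (conf_time \<alpha> t) (x 0)"
proof -
  define y where "y \<tau> = x (conf_clock \<alpha> \<tau>)" for \<tau>
  from x have xc: "continuous_on {0..} x"
    and dx: "\<And>t. t > 0 \<Longrightarrow> (x has_vector_derivative t powr (\<alpha> - 1) *\<^sub>R C t (x t)) (at t)"
    by (auto simp: conf_solution_iff[OF C])
  have "y (conf_time \<alpha> t) = \<Phi> (conf_time \<alpha> t) (y 0)"
  proof (rule fundamental_solution_unique[OF FS _ _ conf_time_nonneg])
    show "continuous_on {0..} y"
      unfolding y_def
      by (rule continuous_on_compose2[OF xc continuous_on_conf_clock]) (auto simp: conf_clock_nonneg)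
    fix \<tau> :: real assume \<tau>: "\<tau> > 0"
    have "conf_clock \<alpha> \<tau> powr (1 - \<alpha>) * conf_clock \<alpha> \<tau> powr (\<alpha> - 1) = 1"
      using conf_clock_pos[OF \<tau>] by (simp flip: powr_add)
    with vector_diff_chain_at[OF conf_clock_deriv[OF \<tau>, unfolded has_real_derivative_iff_has_vector_derivative] dx[OF conf_clock_pos[OF \<tau>]]]
    show "(y has_vector_derivative C (conf_clock \<alpha> \<tau>) (y \<tau>)) (at \<tau>)"
      by (simp add: o_def y_def[abs_def])
  qed
  then show ?thesis using t by (simp add: y_def conf_clock_time conf_clock_0)
qed

lemma evolution_op_eq:
  assumes "0 \<le> t" "0 \<le> s"
  shows "evolution_op \<alpha> C t s = \<Phi> (conf_time \<alpha> t) o\<^sub>L \<Psi> (conf_time \<alpha> s)"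
  unfolding evolution_op_def
proof (rule the_equality, intro allI impI)
  fix x assume "conf_solution \<alpha> C x"
  from conf_solution_eq_fundamental[OF this assms(1)] conf_solution_eq_fundamental[OF this assms(2)]
  show "x t = (\<Phi> (conf_time \<alpha> t) o\<^sub>L \<Psi> (conf_time \<alpha> s)) (x s)"
    by (simp add: fundamental_solution_inverse_apply(2)[OF FS conf_time_nonneg])
next
  fix S assume S: "\<forall>x. conf_solution \<alpha> C x \<longrightarrow> x t = blinfun_apply S (x s)"
  show "S = \<Phi> (conf_time \<alpha> t) o\<^sub>L \<Psi> (conf_time \<alpha> s)"
  proof (rule blinfun_eqI)
    fix v
    \<comment> \<open>Uniqueness of the operator: every \<open>v\<close> is the value at time
      \<open>s\<close> of some solution, namely the one that starts at
      \<open>\<Psi> (conf_time \<alpha> s) v\<close>.\<close>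
    from S conf_solution_fundamental[of "\<Psi> (conf_time \<alpha> s) v"]
    have "\<Phi> (conf_time \<alpha> t) (\<Psi> (conf_time \<alpha> s) v) = S (\<Phi> (conf_time \<alpha> s) (\<Psi> (conf_time \<alpha> s) v))"
      by blast
    then show "S v = (\<Phi> (conf_time \<alpha> t) o\<^sub>L \<Psi> (conf_time \<alpha> s)) v"
      by (simp add: fundamental_solution_inverse_apply(1)[OF FS conf_time_nonneg])
  qed
qed

end

end

section \<open>The perturbed dichotomy in exponential time\<close>

text \<open>The majorant has the explicit antiderivative \<open>G\<close>. In the \<open>m\<close>
  term the contribution of the lower endpoint is dropped, but in the \<open>K\<close> term it is
  kept, because \<open>exp_combination_le\<close> needs the exact difference of exponentials. The
  rate \<kappa> may be negative.\<close>

lemma norm_integral_le_forward_exp: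
  fixes f :: "real \<Rightarrow> 'w::banach"
  assumes "s \<le> t" and f: "continuous_on {s..t} f" and "\<beta> > 0" "\<beta> + \<kappa> > 0" "0 \<le> N" "0 \<le> m"
    and bd: "\<And>\<tau>. s \<le> \<tau> \<Longrightarrow> \<tau> \<le> t \<Longrightarrow> norm (f \<tau>) \<le> N * exp (- \<beta> * (t - \<tau>)) * (m + K * exp (\<kappa> * (\<tau> - p)))"
  shows "norm (integral {s..t} f) \<le>
    N * (m / \<beta> + K / (\<beta> + \<kappa>) * (exp (\<kappa> * (t - p)) - exp (- \<beta> * (t - s) + \<kappa> * (s - p))))"
proof -
  define G where "G \<tau> = N * (m / \<beta> * exp (- \<beta> * (t - \<tau>)) + K / (\<beta> + \<kappa>) * exp (- \<beta> * (t - \<tau>) + \<kappa> * (\<tau> - p)))" for \<tau>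
  let ?g = "\<lambda>\<tau>. N * exp (- \<beta> * (t - \<tau>)) * (m + K * exp (\<kappa> * (\<tau> - p)))"
  have "(?g has_integral G t - G s) {s..t}"
  proof (rule fundamental_theorem_of_calculus[OF \<open>s \<le> t\<close>])
    fix \<tau> assume "\<tau> \<in> {s..t}"
    have e1: "((\<lambda>\<tau>. exp (- \<beta> * (t - \<tau>))) has_real_derivative \<beta> * exp (- \<beta> * (t - \<tau>))) (at \<tau> within {s..t})"
      by (auto intro!: derivative_eq_intros)
    have e2: "((\<lambda>\<tau>. exp (- \<beta> * (t - \<tau>) + \<kappa> * (\<tau> - p))) has_real_derivative
        (\<beta> + \<kappa>) * exp (- \<beta> * (t - \<tau>) + \<kappa> * (\<tau> - p))) (at \<tau> within {s..t})"
      by (auto intro!: derivative_eq_intros)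
    have "(G has_real_derivative N * (m / \<beta> * (\<beta> * exp (- \<beta> * (t - \<tau>))) +
        K / (\<beta> + \<kappa>) * ((\<beta> + \<kappa>) * exp (- \<beta> * (t - \<tau>) + \<kappa> * (\<tau> - p))))) (at \<tau> within {s..t})"
      unfolding G_def by (intro DERIV_cmult DERIV_add e1 e2)
    also have "N * (m / \<beta> * (\<beta> * exp (- \<beta> * (t - \<tau>))) +
        K / (\<beta> + \<kappa>) * ((\<beta> + \<kappa>) * exp (- \<beta> * (t - \<tau>) + \<kappa> * (\<tau> - p)))) = ?g \<tau>"
      unfolding exp_add[of "- \<beta> * (t - \<tau>)" "\<kappa> * (\<tau> - p)"]
      using assms(3,4) by (simp add: distrib_left)
    finally have "(G has_real_derivative ?g \<tau>) (at \<tau> within {s..t})" .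
    then show "(G has_vector_derivative ?g \<tau>) (at \<tau> within {s..t})"
      by (simp add: has_real_derivative_iff_has_vector_derivative)
  qed
  moreover have "norm (integral {s..t} f) \<le> integral {s..t} ?g"
    by (rule integral_norm_bound_integral)
      (use bd in \<open>auto intro!: integrable_continuous_interval f continuous_intros\<close>)
  ultimately have "norm (integral {s..t} f) \<le> G t - G s"
    by (simp add: integral_unique)
  moreover have "0 \<le> N * (m / \<beta> * exp (- \<beta> * (t - s)))"
    using assms by simp
  ultimately show ?thesis
    by (simp add: G_def algebra_simps)
qed

lemma norm_integral_le_backward_exp:
  fixes f :: "real \<Rightarrow> 'w::banach"
  assumes "s \<le> t" and f: "continuous_on {s..t} f" and "\<beta> > 0" "\<beta> + \<kappa> > 0" "0 \<le> N" "0 \<le> m"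
    and bd: "\<And>\<tau>. s \<le> \<tau> \<Longrightarrow> \<tau> \<le> t \<Longrightarrow> norm (f \<tau>) \<le> N * exp (- \<beta> * (\<tau> - s)) * (m + K * exp (\<kappa> * (p - \<tau>)))"
  shows "norm (integral {s..t} f) \<le>
    N * (m / \<beta> + K / (\<beta> + \<kappa>) * (exp (\<kappa> * (p - s)) - exp (- \<beta> * (t - s) + \<kappa> * (p - t))))"
proof -
  have "integral {s..t} f = integral {- t..- s} (\<lambda>\<tau>. f (- \<tau>))"
    by (simp add: integral_reflect_real)
  also have "norm \<dots> \<le> N * (m / \<beta> + K / (\<beta> + \<kappa>) * (exp (\<kappa> * (- s - - p)) - exp (- \<beta> * (- s - - t) + \<kappa> * (- t - - p))))"
  proof (rule norm_integral_le_forward_exp)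
    show "continuous_on {- t..- s} (\<lambda>\<tau>. f (- \<tau>))"
      by (rule continuous_on_compose2[OF f]) (auto intro!: continuous_intros)
    show "norm (f (- \<tau>)) \<le> N * exp (- \<beta> * (- s - \<tau>)) * (m + K * exp (\<kappa> * (\<tau> - - p)))"
      if "- t \<le> \<tau>" "\<tau> \<le> - s" for \<tau>
      using bd[of "- \<tau>"] that by (simp add: algebra_simps)
  qed (use assms in auto)
  finally show ?thesis by (simp add: algebra_simps)
qed

text \<open>Split \<open>E\<close> into the nonnegative pieces \<open>E'\<close> and
  \<open>E - E'\<close>; the two hypotheses bound their coefficients. This is the verification of
  \<open>f + L g \<le> g\<close> for \<open>g = K * E\<close>: \<open>c * E'\<close> comes from the
  boundary value, \<open>a\<close> and \<open>b\<close> from the two integral operators.\<close>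

lemma exp_combination_le:
  fixes a b c :: real
  assumes "0 \<le> E'" "E' \<le> E" "c + b \<le> K" "a + b \<le> K"
  shows "c * E' + a * (E - E') + b * E \<le> K * E"
proof -
  have "c * E' + a * (E - E') + b * E = (c + b) * E' + (a + b) * (E - E')"
    by (simp add: algebra_simps)
  also have "\<dots> \<le> K * E' + K * (E - E')"
    using assms by (intro add_mono mult_right_mono) auto
  finally show ?thesis by (simp add: algebra_simps)
qed

text \<open>Everything is in the new time, and \<open>P\<close> is the projection at time 0: by
  invariance \<open>X t o P o Xi s\<close> is the unperturbed evolution from \<open>s\<close> to
  \<open>t\<close> composed with the projection at \<open>s\<close>. The unperturbed equation enters
  only through these estimates until \<open>mild_solution_iff_fundamental\<close>.\<close>

locale perturbed_dichotomy =
  fixes X Xi B :: "real \<Rightarrow> 'z::banach \<Rightarrow>\<^sub>L 'z" and P :: "'z \<Rightarrow>\<^sub>L 'z"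
    and N1 N2 \<beta>1 \<beta>2 \<epsilon> \<delta> \<theta> :: real
  assumes cont_X: "continuous_on {0..} X" and cont_Xi: "continuous_on {0..} Xi"
    and cont_B: "continuous_on {0..} B"
    and X_0: "X 0 = id_blinfun"
    and X_Xi: "t \<ge> 0 \<Longrightarrow> X t o\<^sub>L Xi t = id_blinfun" and Xi_X: "t \<ge> 0 \<Longrightarrow> Xi t o\<^sub>L X t = id_blinfun"
    and P_P: "P o\<^sub>L P = P"
    and pos: "N1 > 0" "N2 > 0" "\<beta>1 > 0" "\<beta>2 > 0" "\<delta> \<ge> 0"
    and bound_P: "0 \<le> s \<Longrightarrow> s \<le> t \<Longrightarrow>
      norm (X t o\<^sub>L P o\<^sub>L Xi s) \<le> N1 * exp (- \<beta>1 * (t - s)) * exp (\<epsilon> * s)"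
    and bound_Q: "0 \<le> t \<Longrightarrow> t \<le> s \<Longrightarrow>
      norm (X t o\<^sub>L (id_blinfun - P) o\<^sub>L Xi s) \<le> N2 * exp (- \<beta>2 * (s - t)) * exp (\<epsilon> * s)"
    and bound_B: "t \<ge> 0 \<Longrightarrow> norm (B t) \<le> \<delta> * exp (- \<epsilon> * t)"
    and \<theta>_def: "\<theta> = \<delta> * (N1 / \<beta>1 + N2 / \<beta>2)" and \<theta>_less_1: "\<theta> < 1"
    and \<epsilon>_less: "\<epsilon> < \<beta>2"
begin

abbreviation Q :: "'z \<Rightarrow>\<^sub>L 'z" where "Q \<equiv> id_blinfun - P"

lemma \<theta>_nonneg: "0 \<le> \<theta>" using pos by (simp add: \<theta>_def)

lemma Xi_0: "Xi 0 = id_blinfun" using X_Xi[of 0] by (simp add: X_0)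

lemma X_Xi_apply: "t \<ge> 0 \<Longrightarrow> X t (Xi t v) = v"
  using X_Xi[of t] by (metis blinfun_apply_blinfun_compose id_blinfun.rep_eq id_apply)

lemma P_P_apply: "P (P v) = P v"
  using P_P by (metis blinfun_apply_blinfun_compose)

lemma P_Q_apply: "P (Q v) = 0"
  by (simp add: blinfun.diff_left blinfun.diff_right P_P_apply)

lemma dichotomy_split: "t \<ge> 0 \<Longrightarrow> v = X t (P (Xi t v)) + X t (Q (Xi t v))"
  by (simp add: blinfun.diff_left blinfun.diff_right X_Xi_apply)

lemma norm_B_apply_le: "s \<ge> 0 \<Longrightarrow> norm (B s v) \<le> \<delta> * exp (- \<epsilon> * s) * norm v"
  using norm_blinfun[of "B s" v] mult_right_mono[OF bound_B[of s] norm_ge_zero[of v]] by linarith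

lemma bound_P_B:
  assumes "0 \<le> s" "s \<le> t"
  shows "norm (X t (P (Xi s (B s v)))) \<le> N1 * \<delta> * exp (- \<beta>1 * (t - s)) * norm v"
proof -
  have "norm (X t (P (Xi s (B s v)))) \<le> norm (X t o\<^sub>L P o\<^sub>L Xi s) * norm (B s v)"
    using norm_blinfun[of "X t o\<^sub>L P o\<^sub>L Xi s" "B s v"] by simp
  also have "\<dots> \<le> N1 * exp (- \<beta>1 * (t - s)) * exp (\<epsilon> * s) * (\<delta> * exp (- \<epsilon> * s) * norm v)"
    using assms pos by (intro mult_mono bound_P norm_B_apply_le) auto
  also have "\<dots> = N1 * \<delta> * exp (- \<beta>1 * (t - s)) * norm v * (exp (\<epsilon> * s) * exp (- \<epsilon> * s))"
    by simp
  also have "exp (\<epsilon> * s) * exp (- \<epsilon> * s) = 1" by (simp add: mult_exp_exp)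
  finally show ?thesis by simp
qed

lemma bound_Q_B:
  assumes "0 \<le> t" "t \<le> s"
  shows "norm (X t (Q (Xi s (B s v)))) \<le> N2 * \<delta> * exp (- \<beta>2 * (s - t)) * norm v"
proof -
  have "norm (X t (Q (Xi s (B s v)))) \<le> norm (X t o\<^sub>L Q o\<^sub>L Xi s) * norm (B s v)"
    using norm_blinfun[of "X t o\<^sub>L Q o\<^sub>L Xi s" "B s v"] by simp
  also have "\<dots> \<le> N2 * exp (- \<beta>2 * (s - t)) * exp (\<epsilon> * s) * (\<delta> * exp (- \<epsilon> * s) * norm v)"
    using assms pos by (intro mult_mono bound_Q norm_B_apply_le) auto
  also have "\<dots> = N2 * \<delta> * exp (- \<beta>2 * (s - t)) * norm v * (exp (\<epsilon> * s) * exp (- \<epsilon> * s))"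
    by simp
  also have "exp (\<epsilon> * s) * exp (- \<epsilon> * s) = 1" by (simp add: mult_exp_exp)
  finally show ?thesis by simp
qed

lemma cont_integrand:
  assumes "continuous_on {0..} x" "0 \<le> s"
  shows "continuous_on {s..t} (\<lambda>\<tau>. Xi \<tau> (B \<tau> (x \<tau>)))"
  by (rule continuous_on_subset[of "{0..}"]) (use assms cont_Xi cont_B in \<open>auto intro!: continuous_intros\<close>)

lemma blinfun_integral:
  fixes L :: "'z \<Rightarrow>\<^sub>L 'w::banach"
  assumes "continuous_on {0..} x" "0 \<le> s"
  shows "blinfun_apply L (integral {s..t} (\<lambda>\<tau>. Xi \<tau> (B \<tau> (x \<tau>)))) = integral {s..t} (\<lambda>\<tau>. blinfun_apply L (Xi \<tau> (B \<tau> (x \<tau>))))"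
  using integral_linear[OF integrable_continuous_interval[OF cont_integrand[OF assms]] blinfun.bounded_linear_right[of L]]
  by (simp add: o_def)

text \<open>In the decay bounds, \<open>m\<close> is the current error and the \<open>K\<close> term
  is the comparison function; \<kappa> is negative or positive according to whether it decays or
  grows. With \<open>K = 0\<close> the same estimate serves the contraction.\<close>

lemma norm_P_integral_le:
  assumes x: "continuous_on {0..} x" and st: "0 \<le> s" "s \<le> t" and "\<beta>1 + \<kappa> > 0" "0 \<le> m"
    and bd: "\<And>\<tau>. s \<le> \<tau> \<Longrightarrow> \<tau> \<le> t \<Longrightarrow> norm (x \<tau>) \<le> m + K * exp (\<kappa> * (\<tau> - p))"
  shows "norm (X t (P (integral {s..t} (\<lambda>\<tau>. Xi \<tau> (B \<tau> (x \<tau>)))))) \<le>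
    N1 * \<delta> * (m / \<beta>1 + K / (\<beta>1 + \<kappa>) * (exp (\<kappa> * (t - p)) - exp (- \<beta>1 * (t - s) + \<kappa> * (s - p))))"
proof -
  have "X t (P (integral {s..t} (\<lambda>\<tau>. Xi \<tau> (B \<tau> (x \<tau>))))) = integral {s..t} (\<lambda>\<tau>. X t (P (Xi \<tau> (B \<tau> (x \<tau>)))))"
    using blinfun_integral[OF x st(1), of "X t o\<^sub>L P" t] by simp
  moreover have "norm (integral {s..t} (\<lambda>\<tau>. X t (P (Xi \<tau> (B \<tau> (x \<tau>)))))) \<le>
    N1 * \<delta> * (m / \<beta>1 + K / (\<beta>1 + \<kappa>) * (exp (\<kappa> * (t - p)) - exp (- \<beta>1 * (t - s) + \<kappa> * (s - p))))"
  proof (rule norm_integral_le_forward_exp)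
    fix \<tau> assume \<tau>: "s \<le> \<tau>" "\<tau> \<le> t"
    have "norm (X t (P (Xi \<tau> (B \<tau> (x \<tau>))))) \<le> N1 * \<delta> * exp (- \<beta>1 * (t - \<tau>)) * norm (x \<tau>)"
      using \<tau> st by (intro bound_P_B) auto
    also have "\<dots> \<le> N1 * \<delta> * exp (- \<beta>1 * (t - \<tau>)) * (m + K * exp (\<kappa> * (\<tau> - p)))"
      using pos by (intro mult_left_mono bd \<tau>) auto
    finally show "norm (X t (P (Xi \<tau> (B \<tau> (x \<tau>))))) \<le> N1 * \<delta> * exp (- \<beta>1 * (t - \<tau>)) * (m + K * exp (\<kappa> * (\<tau> - p)))" .
  qed (use assms pos in \<open>simp_all add: cont_integrand blinfun.continuous_on[OF continuous_on_const]\<close>)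
  ultimately show ?thesis by simp
qed

lemma norm_Q_integral_le:
  assumes x: "continuous_on {0..} x" and st: "0 \<le> s" "s \<le> t" and "\<beta>2 + \<kappa> > 0" "0 \<le> m"
    and bd: "\<And>\<tau>. s \<le> \<tau> \<Longrightarrow> \<tau> \<le> t \<Longrightarrow> norm (x \<tau>) \<le> m + K * exp (\<kappa> * (p - \<tau>))"
  shows "norm (X s (Q (integral {s..t} (\<lambda>\<tau>. Xi \<tau> (B \<tau> (x \<tau>)))))) \<le>
    N2 * \<delta> * (m / \<beta>2 + K / (\<beta>2 + \<kappa>) * (exp (\<kappa> * (p - s)) - exp (- \<beta>2 * (t - s) + \<kappa> * (p - t))))"
proof -
  have "X s (Q (integral {s..t} (\<lambda>\<tau>. Xi \<tau> (B \<tau> (x \<tau>))))) = integral {s..t} (\<lambda>\<tau>. X s (Q (Xi \<tau> (B \<tau> (x \<tau>)))))"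
    using blinfun_integral[OF x st(1), of "X s o\<^sub>L Q" t] by simp
  moreover have "norm (integral {s..t} (\<lambda>\<tau>. X s (Q (Xi \<tau> (B \<tau> (x \<tau>)))))) \<le>
    N2 * \<delta> * (m / \<beta>2 + K / (\<beta>2 + \<kappa>) * (exp (\<kappa> * (p - s)) - exp (- \<beta>2 * (t - s) + \<kappa> * (p - t))))"
  proof (rule norm_integral_le_backward_exp)
    fix \<tau> assume \<tau>: "s \<le> \<tau>" "\<tau> \<le> t"
    have "norm (X s (Q (Xi \<tau> (B \<tau> (x \<tau>))))) \<le> N2 * \<delta> * exp (- \<beta>2 * (\<tau> - s)) * norm (x \<tau>)"
      using \<tau> st by (intro bound_Q_B) auto
    also have "\<dots> \<le> N2 * \<delta> * exp (- \<beta>2 * (\<tau> - s)) * (m + K * exp (\<kappa> * (p - \<tau>)))"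
      using pos by (intro mult_left_mono bd \<tau>) auto
    finally show "norm (X s (Q (Xi \<tau> (B \<tau> (x \<tau>))))) \<le> N2 * \<delta> * exp (- \<beta>2 * (\<tau> - s)) * (m + K * exp (\<kappa> * (p - \<tau>)))" .
  qed (use assms pos in \<open>simp_all add: cont_integrand blinfun.continuous_on[OF continuous_on_const]\<close>)
  ultimately show ?thesis by simp
qed

text \<open>The variation of constants formula with \<open>X t\<close> moved to the left-hand side,
  so that the integrand does not depend on \<open>t\<close>.\<close>

definition mild_solution :: "(real \<Rightarrow> 'z) \<Rightarrow> bool" where
  "mild_solution x \<longleftrightarrow> continuous_on {0..} x \<and>
     (\<forall>t\<ge>0. Xi t (x t) = x 0 + integral {0..t} (\<lambda>\<tau>. Xi \<tau> (B \<tau> (x \<tau>))))"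

lemma mild_solution_cont: "mild_solution x \<Longrightarrow> continuous_on {0..} x"
  by (simp add: mild_solution_def)

lemma mild_solution_between:
  assumes x: "mild_solution x" and st: "0 \<le> s" "s \<le> t"
  shows "Xi t (x t) = Xi s (x s) + integral {s..t} (\<lambda>\<tau>. Xi \<tau> (B \<tau> (x \<tau>)))"
proof -
  have "integral {0..s} (\<lambda>\<tau>. Xi \<tau> (B \<tau> (x \<tau>))) + integral {s..t} (\<lambda>\<tau>. Xi \<tau> (B \<tau> (x \<tau>))) =
      integral {0..t} (\<lambda>\<tau>. Xi \<tau> (B \<tau> (x \<tau>)))"
    using st by (intro Henstock_Kurzweil_Integration.integral_combine integrable_continuous_interval cont_integrand
        mild_solution_cont x) auto
  with x st show ?thesis by (simp add: mild_solution_def add.assoc)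
qed

text \<open>The \<open>P\<close> part is propagated forwards from an earlier time, the
  \<open>Q\<close> part in \<open>Q_part\<close> backwards from a later one; these are the
  directions in which the dichotomy bounds decay.\<close>

lemma P_part:
  assumes "mild_solution x" "0 \<le> s" "s \<le> t"
  shows "X t (P (Xi t (x t))) = X t (P (Xi s (x s))) + X t (P (integral {s..t} (\<lambda>\<tau>. Xi \<tau> (B \<tau> (x \<tau>)))))"
  using mild_solution_between[OF assms] by (simp add: blinfun.add_right)

lemma Q_part:
  assumes "mild_solution x" "0 \<le> t" "t \<le> b"
  shows "X t (Q (Xi t (x t))) = X t (Q (Xi b (x b))) - X t (Q (integral {t..b} (\<lambda>\<tau>. Xi \<tau> (B \<tau> (x \<tau>)))))"
  using mild_solution_between[OF assms] by (simp add: blinfun.add_right)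

text \<open>The comparison argument with \<open>f = c * exp (- \<beta>1 * (t - s))\<close> and
  \<open>g = K * exp (- l * (t - s))\<close>; \<open>cK\<close> and \<open>K'\<close> encode
  \<open>f + L g \<le> g\<close>. The bound \<open>M\<close> starts the iteration and also removes
  the boundary term of the \<open>Q\<close> part at infinity.\<close>

lemma stable_bound:
  assumes x: "mild_solution x" and M: "\<And>t. t \<ge> 0 \<Longrightarrow> norm (x t) \<le> M"
    and s: "0 \<le> s" and c: "\<And>t. t \<ge> s \<Longrightarrow> norm (X t (P (Xi s (x s)))) \<le> c * exp (- \<beta>1 * (t - s))"
    and l: "0 \<le> l" "l < \<beta>1" and K: "0 \<le> K"
    and cK: "c + K * (N2 * \<delta> / (\<beta>2 + l)) \<le> K"
    and K': "K * (N1 * \<delta> / (\<beta>1 - l)) + K * (N2 * \<delta> / (\<beta>2 + l)) \<le> K"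
    and t: "s \<le> t"
  shows "norm (x t) \<le> K * exp (- l * (t - s))"
proof -
  have M0: "0 \<le> M" using M[of 0] norm_ge_zero[of "x 0"] by linarith
  have "norm (x t) \<le> \<theta> ^ n * M + K * exp (- l * (t - s))" if "s \<le> t" for n t
    using that
  proof (induction n arbitrary: t)
    case 0
    then show ?case using M[of t] s K by (simp add: add_increasing2)
  next
    case (Suc n)
    define m where "m = \<theta> ^ n * M"
    have m: "0 \<le> m" using \<theta>_nonneg M0 by (simp add: m_def)
    define E where "E = exp (- l * (t - s))"
    define E' where "E' = exp (- \<beta>1 * (t - s))"
    have E: "0 \<le> E'" "E' \<le> E" using l Suc.prems by (auto simp: E_def E'_def mult_right_mono)
    have bdP: "norm (X t (P (integral {s..t} (\<lambda>\<tau>. Xi \<tau> (B \<tau> (x \<tau>)))))) \<le>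
        N1 * \<delta> * (m / \<beta>1 + K / (\<beta>1 + - l) * (exp (- l * (t - s)) - exp (- \<beta>1 * (t - s) + - l * (s - s))))"
      by (rule norm_P_integral_le[OF mild_solution_cont[OF x] s Suc.prems])
        (use l m Suc.IH in \<open>auto simp: m_def\<close>)
    then have "norm (X t (P (Xi t (x t)))) \<le> c * E' + N1 * \<delta> * (m / \<beta>1 + K / (\<beta>1 - l) * (E - E'))"
      using c[OF Suc.prems] by (simp add: P_part[OF x s Suc.prems] E_def E'_def norm_triangle_mono)
    then have 1: "norm (X t (P (Xi t (x t)))) \<le> c * E' + \<delta> * N1 / \<beta>1 * m + K * (N1 * \<delta> / (\<beta>1 - l)) * (E - E')"
      by (simp add: algebra_simps)
    \<comment> \<open>The endpoint \<open>b\<close> is kept free. Its boundary term is estimated by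
      the crude bound \<open>M\<close>, and the negative endpoint term of the integral estimate is
      discarded.\<close>
    have "norm (X t (Q (Xi t (x t)))) \<le> N2 * M * exp (\<beta>2 * t) * exp (- (\<beta>2 - \<epsilon>) * b) + N2 * \<delta> * (m / \<beta>2 + K / (\<beta>2 + l) * E)"
      if "t \<le> b" for b
    proof -
      have t0: "0 \<le> t" using s Suc.prems by simp
      have "norm (X t (Q (Xi b (x b)))) \<le> norm (X t o\<^sub>L Q o\<^sub>L Xi b) * norm (x b)"
        using norm_blinfun[of "X t o\<^sub>L Q o\<^sub>L Xi b" "x b"] by simp
      also have "\<dots> \<le> N2 * exp (- \<beta>2 * (b - t)) * exp (\<epsilon> * b) * M"
        using pos t0 that by (intro mult_mono bound_Q M) auto
      also have "\<dots> = N2 * M * (exp (- \<beta>2 * (b - t)) * exp (\<epsilon> * b))" by simp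
      also have "exp (- \<beta>2 * (b - t)) * exp (\<epsilon> * b) = exp (\<beta>2 * t) * exp (- (\<beta>2 - \<epsilon>) * b)"
        by (simp add: mult_exp_exp algebra_simps)
      finally have 2: "norm (X t (Q (Xi b (x b)))) \<le> N2 * M * exp (\<beta>2 * t) * exp (- (\<beta>2 - \<epsilon>) * b)"
        by simp
      have "norm (X t (Q (integral {t..b} (\<lambda>\<tau>. Xi \<tau> (B \<tau> (x \<tau>)))))) \<le>
        N2 * \<delta> * (m / \<beta>2 + K / (\<beta>2 + l) * (exp (l * (s - t)) - exp (- \<beta>2 * (b - t) + l * (s - b))))"
      proof (rule norm_Q_integral_le[OF mild_solution_cont[OF x] t0 that])
        show "norm (x \<tau>) \<le> m + K * exp (l * (s - \<tau>))" if "t \<le> \<tau>" for \<tau>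
          using Suc.IH[of \<tau>] that Suc.prems by (simp add: m_def algebra_simps)
      qed (use l pos m in auto)
      also have "\<dots> \<le> N2 * \<delta> * (m / \<beta>2 + K / (\<beta>2 + l) * E)"
        using pos l K by (intro mult_left_mono add_mono) (auto simp: E_def algebra_simps)
      finally show ?thesis
        unfolding Q_part[OF x t0 that] using 2 norm_triangle_ineq4 by (smt (verit))
    qed
    note 2 = this
    have "\<forall>\<^sub>F b :: nat in sequentially. norm (X t (Q (Xi t (x t)))) \<le>
        N2 * M * exp (\<beta>2 * t) * exp (- (\<beta>2 - \<epsilon>) * real b) + N2 * \<delta> * (m / \<beta>2 + K / (\<beta>2 + l) * E)"
      by (rule eventually_mono[OF eventually_ge_at_top[of "nat \<lceil>t\<rceil>"]]) (rule 2, linarith)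
    \<comment> \<open>Since \<open>\<epsilon> < \<beta>2\<close>, the decay of the dichotomy beats
      its nonuniform weight at the endpoint.\<close>
    moreover have "(\<lambda>b. exp (- (\<beta>2 - \<epsilon>) * real b)) \<longlonglongrightarrow> 0"
      using \<epsilon>_less by real_asymp
    then have "(\<lambda>b. N2 * M * exp (\<beta>2 * t) * exp (- (\<beta>2 - \<epsilon>) * real b) + N2 * \<delta> * (m / \<beta>2 + K / (\<beta>2 + l) * E))
        \<longlonglongrightarrow> N2 * M * exp (\<beta>2 * t) * 0 + N2 * \<delta> * (m / \<beta>2 + K / (\<beta>2 + l) * E)"
      by (intro tendsto_intros)
    ultimately have "norm (X t (Q (Xi t (x t)))) \<le> N2 * \<delta> * (m / \<beta>2 + K / (\<beta>2 + l) * E)"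
      using tendsto_lowerbound[of _ _ sequentially] by force
    then have 2: "norm (X t (Q (Xi t (x t)))) \<le> \<delta> * N2 / \<beta>2 * m + K * (N2 * \<delta> / (\<beta>2 + l)) * E"
      by (simp add: algebra_simps)
    have "norm (x t) \<le> norm (X t (P (Xi t (x t)))) + norm (X t (Q (Xi t (x t))))"
      using dichotomy_split[of t "x t"] norm_triangle_ineq[of "X t (P (Xi t (x t)))" "X t (Q (Xi t (x t)))"] s Suc.prems
      by simp
    \<comment> \<open>The error contributions of the two parts add up to
      \<open>\<theta> * m\<close>, by the definition of \<theta>.\<close>
    also have "\<dots> \<le> \<theta> * m + K * E"
      using 1 2 exp_combination_le[OF E cK K'] by (simp add: \<theta>_def algebra_simps)
    finally show ?case by (simp add: m_def E_def)
  qed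
  from this[OF t] have "\<And>n. norm (x t) \<le> \<theta> ^ n * M + K * exp (- l * (t - s))" .
  moreover have "(\<lambda>n. \<theta> ^ n * M + K * exp (- l * (t - s))) \<longlonglongrightarrow> 0 * M + K * exp (- l * (t - s))"
    using \<theta>_nonneg \<theta>_less_1 by (intro tendsto_intros LIMSEQ_realpow_zero) auto
  ultimately show ?thesis
    using LIMSEQ_le_const by (metis (no_types, lifting) add_0 mult_zero_left)
qed

text \<open>The same iteration on the compact interval from 0 to \<open>s\<close>, where continuity
  supplies the initial bound. The \<open>P\<close> part is integrated from 0, where its boundary
  term vanishes because \<open>P (x 0) = 0\<close>; the \<open>Q\<close> part keeps its boundary
  value at \<open>s\<close>.\<close>

lemma unstable_bound:
  assumes x: "mild_solution x" and P0: "P (x 0) = 0"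
    and c: "\<And>t. 0 \<le> t \<Longrightarrow> t \<le> s \<Longrightarrow> norm (X t (Q (Xi s (x s)))) \<le> c * exp (- \<beta>2 * (s - t))"
    and l: "0 \<le> l" "l < \<beta>2" and K: "0 \<le> K"
    and cK: "c + K * (N1 * \<delta> / (\<beta>1 + l)) \<le> K"
    and K': "K * (N2 * \<delta> / (\<beta>2 - l)) + K * (N1 * \<delta> / (\<beta>1 + l)) \<le> K"
    and t: "0 \<le> t" "t \<le> s"
  shows "norm (x t) \<le> K * exp (- l * (s - t))"
proof -
  have "compact (x ` {0..s})"
    by (intro compact_continuous_image continuous_on_subset[OF mild_solution_cont[OF x]]) auto
  then obtain M where M: "\<And>t. 0 \<le> t \<Longrightarrow> t \<le> s \<Longrightarrow> norm (x t) \<le> M"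
    by (meson atLeastAtMost_iff compact_imp_bounded bounded_iff imageI)
  have M0: "0 \<le> M" using M[OF t] norm_ge_zero[of "x t"] by linarith
  have "norm (x t) \<le> \<theta> ^ n * M + K * exp (- l * (s - t))" if "0 \<le> t" "t \<le> s" for n t
    using that
  proof (induction n arbitrary: t)
    case 0
    then show ?case using M[of t] K by (simp add: add_increasing2)
  next
    case (Suc n)
    define m where "m = \<theta> ^ n * M"
    have m: "0 \<le> m" using \<theta>_nonneg M0 by (simp add: m_def)
    define E where "E = exp (- l * (s - t))"
    define E' where "E' = exp (- \<beta>2 * (s - t))"
    have E: "0 \<le> E'" "E' \<le> E" using l Suc.prems by (auto simp: E_def E'_def mult_right_mono)
    have "norm (X t (Q (integral {t..s} (\<lambda>\<tau>. Xi \<tau> (B \<tau> (x \<tau>)))))) \<le>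
        N2 * \<delta> * (m / \<beta>2 + K / (\<beta>2 + - l) * (exp (- l * (s - t)) - exp (- \<beta>2 * (s - t) + - l * (s - s))))"
      by (rule norm_Q_integral_le[OF mild_solution_cont[OF x] Suc.prems])
        (use l m Suc.IH Suc.prems in \<open>auto simp: m_def\<close>)
    then have "norm (X t (Q (Xi t (x t)))) \<le> c * E' + N2 * \<delta> * (m / \<beta>2 + K / (\<beta>2 - l) * (E - E'))"
      unfolding Q_part[OF x Suc.prems]
      using c[OF Suc.prems] by (intro order_trans[OF norm_triangle_ineq4] add_mono) (simp_all add: E_def E'_def)
    then have 1: "norm (X t (Q (Xi t (x t)))) \<le> c * E' + \<delta> * N2 / \<beta>2 * m + K * (N2 * \<delta> / (\<beta>2 - l)) * (E - E')"
      by (simp add: algebra_simps)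
    have "norm (X t (P (integral {0..t} (\<lambda>\<tau>. Xi \<tau> (B \<tau> (x \<tau>)))))) \<le>
        N1 * \<delta> * (m / \<beta>1 + K / (\<beta>1 + l) * (exp (l * (t - s)) - exp (- \<beta>1 * (t - 0) + l * (0 - s))))"
    proof (rule norm_P_integral_le[OF mild_solution_cont[OF x] order_refl Suc.prems(1)])
      show "norm (x \<tau>) \<le> m + K * exp (l * (\<tau> - s))" if "0 \<le> \<tau>" "\<tau> \<le> t" for \<tau>
        using Suc.IH[of \<tau>] that Suc.prems by (simp add: m_def algebra_simps)
    qed (use l pos m in auto)
    also have "\<dots> \<le> N1 * \<delta> * (m / \<beta>1 + K / (\<beta>1 + l) * E)"
      using pos l K by (intro mult_left_mono add_mono) (auto simp: E_def algebra_simps)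
    finally have 2: "norm (X t (P (Xi t (x t)))) \<le> \<delta> * N1 / \<beta>1 * m + K * (N1 * \<delta> / (\<beta>1 + l)) * E"
      unfolding P_part[OF x order_refl Suc.prems(1)] by (simp add: Xi_0 P0 algebra_simps)
    have "norm (x t) \<le> norm (X t (P (Xi t (x t)))) + norm (X t (Q (Xi t (x t))))"
      using dichotomy_split[of t "x t"] norm_triangle_ineq[of "X t (P (Xi t (x t)))" "X t (Q (Xi t (x t)))"] Suc.prems
      by simp
    also have "\<dots> \<le> \<theta> * m + K * E"
      using 1 2 exp_combination_le[OF E cK K'] by (simp add: \<theta>_def algebra_simps)
    finally show ?case by (simp add: m_def E_def)
  qed
  from this[OF t] have "\<And>n. norm (x t) \<le> \<theta> ^ n * M + K * exp (- l * (s - t))" .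
  moreover have "(\<lambda>n. \<theta> ^ n * M + K * exp (- l * (s - t))) \<longlonglongrightarrow> 0 * M + K * exp (- l * (s - t))"
    using \<theta>_nonneg \<theta>_less_1 by (intro tendsto_intros LIMSEQ_realpow_zero) auto
  ultimately show ?thesis
    using LIMSEQ_le_const by (metis (no_types, lifting) add_0 mult_zero_left)
qed

end

section \<open>Bounded operator-valued solutions by contraction\<close>

lemma integral_has_vector_derivative_half_line:
  fixes h :: "real \<Rightarrow> 'a::banach"
  assumes h: "continuous_on {0..} h" and t: "t \<ge> 0"
  shows "((\<lambda>t. integral {0..t} h) has_vector_derivative h t) (at t within {0..})"
proof -
  have "at t within {0..} = at t within {0..t+1}"
    by (rule at_within_nhd[of _ "{..<t+1}"]) auto
  then show ?thesis
    using integral_has_vector_derivative[of 0 "t+1" h t] t continuous_on_subset[OF h, of "{0..t+1}"] by auto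
qed

context perturbed_dichotomy begin

definition op_integrand :: "(real \<Rightarrow> 'z \<Rightarrow>\<^sub>L 'z) \<Rightarrow> real \<Rightarrow> 'z \<Rightarrow>\<^sub>L 'z" where
  "op_integrand Y \<tau> = (Xi \<tau> o\<^sub>L B \<tau> o\<^sub>L Y \<tau>)"

lemma cont_op_integrand: "continuous_on {0..} Y \<Longrightarrow> continuous_on {0..} (op_integrand Y)"
  unfolding op_integrand_def using cont_Xi cont_B
  by (intro bounded_bilinear.continuous_on[OF bounded_bilinear_blinfun_compose])

lemma op_integrand_integrable:
  assumes "continuous_on {0..} Y" "0 \<le> s"
  shows "op_integrand Y integrable_on {s..t}"
  using assms by (intro integrable_continuous_interval continuous_on_subset[OF cont_op_integrand]) auto

lemma op_integral_apply:
  assumes "continuous_on {0..} Y" "0 \<le> s"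
  shows "integral {s..t} (op_integrand Y) v = integral {s..t} (\<lambda>\<tau>. Xi \<tau> (B \<tau> (Y \<tau> v)))"
  using integral_linear[OF op_integrand_integrable[OF assms] blinfun.bounded_linear_left[of v], of t]
  by (simp add: o_def op_integrand_def)

lemma op_integral_combine:
  assumes "continuous_on {0..} Y" "0 \<le> s" "s \<le> t"
  shows "integral {0..t} (op_integrand Y) - integral {0..s} (op_integrand Y) = integral {s..t} (op_integrand Y)"
  using Henstock_Kurzweil_Integration.integral_combine[OF assms(2,3) op_integrand_integrable[OF assms(1) order_refl]]
  by (simp add: algebra_simps)

lemma continuous_on_apply: "continuous_on {0..} Y \<Longrightarrow> continuous_on {0..} (\<lambda>t. blinfun_apply (Y t) v)"
  by (rule blinfun.continuous_on[OF _ continuous_on_const])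

lemma norm_blinfun_apply_le: "norm L \<le> m \<Longrightarrow> norm (blinfun_apply L v) \<le> m * norm v"
  by (meson norm_blinfun mult_right_mono norm_ge_zero order_trans)

text \<open>The improper integral of \<open>Q Xi B Y\<close> over the half-line, taken along integer
  endpoints. For bounded continuous \<open>Y\<close> the limit exists by
  \<open>Q_op_integral_convergent\<close>.\<close>

definition unstable_limit :: "(real \<Rightarrow> 'z \<Rightarrow>\<^sub>L 'z) \<Rightarrow> 'z \<Rightarrow>\<^sub>L 'z" where
  "unstable_limit Y = lim (\<lambda>n. Q o\<^sub>L integral {0..real n} (op_integrand Y))"

context
  fixes Y :: "real \<Rightarrow> 'z \<Rightarrow>\<^sub>L 'z" and m :: real
  assumes Y: "continuous_on {0..} Y" and m: "\<And>t. t \<ge> 0 \<Longrightarrow> norm (Y t) \<le> m"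
begin

lemma uniform_bound_nonneg: "0 \<le> m"
  using order_trans[OF norm_ge_zero m[OF order_refl]] .

lemma norm_P_op_integral_le:
  assumes "0 \<le> t"
  shows "norm (X t o\<^sub>L P o\<^sub>L integral {0..t} (op_integrand Y)) \<le> \<delta> * N1 / \<beta>1 * m"
proof (rule norm_blinfun_bound)
  fix v
  have "norm (X t (P (integral {0..t} (\<lambda>\<tau>. Xi \<tau> (B \<tau> (Y \<tau> v)))))) \<le>
      N1 * \<delta> * (m * norm v / \<beta>1 + 0 / (\<beta>1 + 0) * (exp (0 * (t - 0)) - exp (- \<beta>1 * (t - 0) + 0 * (0 - 0))))"
    by (rule norm_P_integral_le[OF continuous_on_apply[OF Y]])
      (use assms m uniform_bound_nonneg pos in \<open>simp_all add: norm_blinfun_apply_le\<close>)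
  then show "norm ((X t o\<^sub>L P o\<^sub>L integral {0..t} (op_integrand Y)) v) \<le> \<delta> * N1 / \<beta>1 * m * norm v"
    by (simp add: op_integral_apply[OF Y] mult_ac)
qed (use pos uniform_bound_nonneg in simp)

lemma norm_Q_op_integral_le:
  assumes "0 \<le> s" "s \<le> t"
  shows "norm (X s o\<^sub>L Q o\<^sub>L integral {s..t} (op_integrand Y)) \<le> \<delta> * N2 / \<beta>2 * m"
proof (rule norm_blinfun_bound)
  fix v
  have "norm (X s (Q (integral {s..t} (\<lambda>\<tau>. Xi \<tau> (B \<tau> (Y \<tau> v)))))) \<le>
      N2 * \<delta> * (m * norm v / \<beta>2 + 0 / (\<beta>2 + 0) * (exp (0 * (0 - s)) - exp (- \<beta>2 * (t - s) + 0 * (0 - t))))"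
    by (rule norm_Q_integral_le[OF continuous_on_apply[OF Y]])
      (use assms m uniform_bound_nonneg pos in \<open>simp_all add: norm_blinfun_apply_le\<close>)
  then show "norm ((X s o\<^sub>L Q o\<^sub>L integral {s..t} (op_integrand Y)) v) \<le> \<delta> * N2 / \<beta>2 * m * norm v"
    using assms by (simp add: op_integral_apply[OF Y] mult_ac)
qed (use pos uniform_bound_nonneg in simp)

text \<open>The dichotomy bound with target time 0 makes the integrand decay like
  \<open>exp (- \<beta>2 * \<tau>)\<close>. The tails are therefore small in operator norm, which
  makes the truncated integrals a Cauchy sequence.\<close>

lemma norm_Q_tail_le:
  assumes "0 \<le> s" "s \<le> t"
  shows "norm (Q o\<^sub>L integral {s..t} (op_integrand Y)) \<le> N2 * \<delta> * m / \<beta>2 * exp (- \<beta>2 * s)"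
proof -
  have "Q o\<^sub>L integral {s..t} (op_integrand Y) = integral {s..t} (\<lambda>\<tau>. Q o\<^sub>L op_integrand Y \<tau>)"
    using integral_linear[OF op_integrand_integrable[OF Y assms(1)]
        bounded_bilinear.bounded_linear_right[OF bounded_bilinear_blinfun_compose, of Q], of t]
    by (simp add: o_def)
  also have "norm \<dots> \<le> N2 * \<delta> * exp (- \<beta>2 * s) * (m / \<beta>2 + 0 / (\<beta>2 + 0) *
      (exp (0 * (0 - s)) - exp (- \<beta>2 * (t - s) + 0 * (0 - t))))"
  proof (rule norm_integral_le_backward_exp)
    have "continuous_on {s..t} (op_integrand Y)"
      using assms by (intro continuous_on_subset[OF cont_op_integrand[OF Y]]) auto
    then show "continuous_on {s..t} (\<lambda>\<tau>. Q o\<^sub>L op_integrand Y \<tau>)"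
      by (rule bounded_bilinear.continuous_on[OF bounded_bilinear_blinfun_compose continuous_on_const])
  next
    fix \<tau> assume \<tau>: "s \<le> \<tau>" "\<tau> \<le> t"
    have "norm (Q o\<^sub>L op_integrand Y \<tau>) \<le> N2 * \<delta> * exp (- \<beta>2 * \<tau>) * m"
    proof (rule norm_blinfun_bound)
      fix v
      have "norm (Q (Xi \<tau> (B \<tau> (Y \<tau> v)))) \<le> N2 * \<delta> * exp (- \<beta>2 * \<tau>) * norm (Y \<tau> v)"
        using bound_Q_B[of 0 \<tau> "Y \<tau> v"] assms \<tau> by (simp add: X_0)
      also have "\<dots> \<le> N2 * \<delta> * exp (- \<beta>2 * \<tau>) * (m * norm v)"
        using pos assms \<tau> by (intro mult_left_mono norm_blinfun_apply_le m) auto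
      finally show "norm ((Q o\<^sub>L op_integrand Y \<tau>) v) \<le> N2 * \<delta> * exp (- \<beta>2 * \<tau>) * m * norm v"
        by (simp add: op_integrand_def mult.assoc)
    qed (use pos uniform_bound_nonneg in simp)
    also have "exp (- \<beta>2 * \<tau>) = exp (- \<beta>2 * s) * exp (- \<beta>2 * (\<tau> - s))"
      by (simp add: mult_exp_exp algebra_simps)
    finally show "norm (Q o\<^sub>L op_integrand Y \<tau>) \<le>
        N2 * \<delta> * exp (- \<beta>2 * s) * exp (- \<beta>2 * (\<tau> - s)) * (m + 0 * exp (0 * (0 - \<tau>)))"
      by (simp add: mult.assoc)
  qed (use assms pos uniform_bound_nonneg in auto)
  finally show ?thesis by (simp add: mult_ac)
qed

lemma Q_op_integral_convergent: "convergent (\<lambda>n. Q o\<^sub>L integral {0..real n} (op_integrand Y))"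
proof -
  let ?F = "\<lambda>t. Q o\<^sub>L integral {0..t} (op_integrand Y)"
  let ?C = "N2 * \<delta> * m / \<beta>2"
  have C: "?C \<ge> 0" using pos uniform_bound_nonneg by simp
  have diff: "norm (?F t - ?F s) \<le> ?C * exp (- \<beta>2 * s)" if "0 \<le> s" "s \<le> t" for s t
    using norm_Q_tail_le[OF that]
    by (simp add: op_integral_combine[OF Y that] flip: blinfun_compose_diff_right)
  have "Cauchy (\<lambda>n. ?F (real n))"
  proof (rule metric_CauchyI)
    fix e :: real assume "e > 0"
    have "(\<lambda>n. ?C * exp (- \<beta>2 * real n)) \<longlonglongrightarrow> ?C * 0"
      using pos by (intro tendsto_mult tendsto_const) real_asymp
    then have "\<forall>\<^sub>F n in sequentially. ?C * exp (- \<beta>2 * real n) < e / 2"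
      using \<open>e > 0\<close> by (intro order_tendstoD) auto
    then obtain M where M: "?C * exp (- \<beta>2 * real M) < e / 2"
      by (auto simp: eventually_sequentially)
    have "dist (?F (real n)) (?F (real M)) < e / 2" if "n \<ge> M" for n
      unfolding dist_norm by (rule le_less_trans[OF diff M]) (use that in auto)
    then show "\<exists>M. \<forall>i\<ge>M. \<forall>j\<ge>M. dist (?F (real i)) (?F (real j)) < e"
      using dist_triangle_half_l by blast
  qed
  then show ?thesis by (rule Cauchy_convergent)
qed

lemma unstable_limit_LIMSEQ: "(\<lambda>n. Q o\<^sub>L integral {0..real n} (op_integrand Y)) \<longlonglongrightarrow> unstable_limit Y"
  using Q_op_integral_convergent unfolding unstable_limit_def by (simp add: convergent_LIMSEQ_iff)

lemma P_unstable_limit: "P o\<^sub>L unstable_limit Y = 0"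
proof -
  have "(\<lambda>n. P o\<^sub>L (Q o\<^sub>L integral {0..real n} (op_integrand Y))) \<longlonglongrightarrow> (P o\<^sub>L unstable_limit Y)"
    by (rule bounded_bilinear.tendsto[OF bounded_bilinear_blinfun_compose tendsto_const unstable_limit_LIMSEQ])
  moreover have "P o\<^sub>L (Q o\<^sub>L L) = 0" for L :: "'z \<Rightarrow>\<^sub>L 'z"
    by (rule blinfun_eqI) (simp add: P_Q_apply)
  ultimately show ?thesis by (simp add: LIMSEQ_const_iff)
qed

text \<open>The operator is the integral of the \<open>P\<close> kernel up to \<open>t\<close> minus
  that of the \<open>Q\<close> kernel from \<open>t\<close> to infinity, the Green operator of the
  dichotomy. The two pieces contribute the two summands of \<theta>.\<close>

lemma norm_green_le:
  assumes t: "0 \<le> t"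
  shows "norm (X t o\<^sub>L (integral {0..t} (op_integrand Y) - unstable_limit Y)) \<le> \<theta> * m"
proof -
  let ?I = "\<lambda>t. integral {0..t} (op_integrand Y)"
  have "(\<lambda>n. norm (X t o\<^sub>L ((Q o\<^sub>L ?I (real n)) - (Q o\<^sub>L ?I t)))) \<longlonglongrightarrow> norm (X t o\<^sub>L (unstable_limit Y - (Q o\<^sub>L ?I t)))"
    by (intro tendsto_norm tendsto_diff unstable_limit_LIMSEQ tendsto_const
        bounded_bilinear.tendsto[OF bounded_bilinear_blinfun_compose])
  moreover have "\<forall>\<^sub>F n in sequentially. norm (X t o\<^sub>L ((Q o\<^sub>L ?I (real n)) - (Q o\<^sub>L ?I t))) \<le> \<delta> * N2 / \<beta>2 * m"
  proof (rule eventually_mono[OF eventually_ge_at_top[of "nat \<lceil>t\<rceil>"]])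
    fix n assume "nat \<lceil>t\<rceil> \<le> n"
    then have n: "t \<le> real n" by linarith
    show "norm (X t o\<^sub>L ((Q o\<^sub>L ?I (real n)) - (Q o\<^sub>L ?I t))) \<le> \<delta> * N2 / \<beta>2 * m"
      using norm_Q_op_integral_le[OF t n]
      by (simp add: op_integral_combine[OF Y t n] blinfun_compose_assoc flip: blinfun_compose_diff_right)
  qed
  ultimately have 1: "norm (X t o\<^sub>L (unstable_limit Y - (Q o\<^sub>L ?I t))) \<le> \<delta> * N2 / \<beta>2 * m"
    by (rule tendsto_upperbound) simp
  have "X t o\<^sub>L (?I t - unstable_limit Y) = (X t o\<^sub>L P o\<^sub>L ?I t) - (X t o\<^sub>L (unstable_limit Y - (Q o\<^sub>L ?I t)))"
    by (rule blinfun_eqI) (simp add: blinfun.diff_left blinfun.diff_right)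
  then have "norm (X t o\<^sub>L (?I t - unstable_limit Y)) \<le> \<delta> * N1 / \<beta>1 * m + \<delta> * N2 / \<beta>2 * m"
    using norm_P_op_integral_le[OF t] 1 by (simp add: norm_triangle_le_diff)
  then show ?thesis by (simp add: \<theta>_def algebra_simps)
qed

end

lemma op_integral_diff:
  assumes "continuous_on {0..} Y" "continuous_on {0..} Y'"
  shows "integral {0..t} (op_integrand (\<lambda>\<tau>. Y \<tau> - Y' \<tau>)) = integral {0..t} (op_integrand Y) - integral {0..t} (op_integrand Y')"
  using integral_diff[OF op_integrand_integrable[OF assms(1) order_refl] op_integrand_integrable[OF assms(2) order_refl]]
  by (simp add: op_integrand_def[abs_def] blinfun_compose_diff_right)

text \<open>The fixed point problem is posed for operators rather than vectors, so that the initial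
  value \<open>Y 0\<close> is directly a bounded linear operator.\<close>

lemma bounded_operator_solution:
  "\<exists>Y M. continuous_on {0..} Y \<and> (\<forall>t\<ge>0. norm (Y t) \<le> M) \<and> P o\<^sub>L Y 0 = P \<and>
    (\<forall>t\<ge>0. Xi t o\<^sub>L Y t = Y 0 + integral {0..t} (op_integrand Y))"
proof -
  define G where "G Y t = (X t o\<^sub>L (P + (integral {0..t} (op_integrand Y) - unstable_limit Y)))" for Y t
  \<comment> \<open>Bounded continuous functions live on the whole line here, so values at negative
    times are frozen at the value at 0.\<close>
  define F where "F Y = Bcontfun (\<lambda>t. G (apply_bcontfun Y) (max 0 t))" for Y :: "real \<Rightarrow>\<^sub>C 'z \<Rightarrow>\<^sub>L 'z"
  have Yc: "continuous_on {0..} (apply_bcontfun Y)" and Yb: "\<And>t. norm (apply_bcontfun Y t) \<le> norm Y"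
    for Y :: "real \<Rightarrow>\<^sub>C 'z \<Rightarrow>\<^sub>L 'z"
    by (auto intro: norm_bounded)
  have XP: "norm (X t o\<^sub>L P) \<le> N1" if "0 \<le> t" for t
  proof -
    have "N1 * exp (- (\<beta>1 * t)) \<le> N1 * 1"
      using pos that by (intro mult_left_mono) auto
    with bound_P[of 0 t] that show ?thesis by (simp add: Xi_0)
  qed
  have F: "apply_bcontfun (F Y) = (\<lambda>t. G (apply_bcontfun Y) (max 0 t))" for Y
    unfolding F_def
  proof (rule Bcontfun_inverse, rule bcontfun_normI)
    let ?I = "\<lambda>t. integral {0..t} (op_integrand (apply_bcontfun Y))"
    have "continuous_on {0..} ?I"
      by (rule continuous_on_vector_derivative)
        (rule integral_has_vector_derivative_half_line[OF cont_op_integrand[OF Yc]], simp)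
    then have "continuous_on {0..} (G (apply_bcontfun Y))"
      unfolding G_def
      by (intro bounded_bilinear.continuous_on[OF bounded_bilinear_blinfun_compose] cont_X continuous_on_add
          continuous_on_diff continuous_on_const)
    then show "continuous_on UNIV (\<lambda>t. G (apply_bcontfun Y) (max 0 t))"
      by (rule continuous_on_compose2) (auto intro!: continuous_intros)
    fix t :: real
    have "norm (G (apply_bcontfun Y) (max 0 t)) \<le> norm (X (max 0 t) o\<^sub>L P) +
        norm (X (max 0 t) o\<^sub>L (?I (max 0 t) - unstable_limit (apply_bcontfun Y)))"
      unfolding G_def bounded_bilinear.add_right[OF bounded_bilinear_blinfun_compose] by (rule norm_triangle_ineq)
    also have "\<dots> \<le> N1 + \<theta> * norm Y"
      by (intro add_mono XP norm_green_le[OF Yc Yb]) auto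
    finally show "norm (G (apply_bcontfun Y) (max 0 t)) \<le> N1 + \<theta> * norm Y" .
  qed
  \<comment> \<open>\<open>G\<close> is affine in \<open>Y\<close>: the constant \<open>P\<close>
    cancels, and the difference is the Green operator applied to \<open>?D\<close>. What needs proof
    is the linearity of \<open>unstable_limit\<close>.\<close>
  have "dist (F Y) (F Y') \<le> \<theta> * dist Y Y'" for Y Y'
  proof (rule dist_bound)
    fix t :: real
    let ?Y = "apply_bcontfun Y" and ?Y' = "apply_bcontfun Y'"
    let ?D = "\<lambda>t. ?Y t - ?Y' t"
    have Dc: "continuous_on {0..} ?D" by (intro continuous_on_diff Yc)
    have Db: "norm (?D s) \<le> dist Y Y'" for s
      using dist_bounded[of Y s Y'] by (simp add: dist_norm)
    have "(\<lambda>n. (Q o\<^sub>L integral {0..real n} (op_integrand ?Y)) - (Q o\<^sub>L integral {0..real n} (op_integrand ?Y')))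
        \<longlonglongrightarrow> unstable_limit ?Y - unstable_limit ?Y'"
      by (intro tendsto_diff unstable_limit_LIMSEQ[OF Yc Yb])
    then have "(\<lambda>n. Q o\<^sub>L integral {0..real n} (op_integrand ?D)) \<longlonglongrightarrow> unstable_limit ?Y - unstable_limit ?Y'"
      by (simp add: op_integral_diff[OF Yc Yc] blinfun_compose_diff_right)
    from LIMSEQ_unique[OF this unstable_limit_LIMSEQ[OF Dc Db]]
    have u: "unstable_limit ?D = unstable_limit ?Y - unstable_limit ?Y'" by simp
    have "G ?Y t - G ?Y' t = (X t o\<^sub>L (integral {0..t} (op_integrand ?D) - unstable_limit ?D))" for t
      unfolding G_def u op_integral_diff[OF Yc Yc]
      by (simp add: algebra_simps flip: blinfun_compose_diff_right)
    then have "norm (G ?Y (max 0 t) - G ?Y' (max 0 t)) \<le> \<theta> * dist Y Y'"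
      using norm_green_le[OF Dc Db, of "max 0 t"] by simp
    then show "dist (apply_bcontfun (F Y) t) (apply_bcontfun (F Y') t) \<le> \<theta> * dist Y Y'"
      by (simp add: F dist_norm)
  qed
  then obtain Y where "F Y = Y"
    using banach_fix_type[OF \<theta>_nonneg \<theta>_less_1, of F] by blast
  with F[of Y] have Y: "apply_bcontfun Y t = G (apply_bcontfun Y) t" if "t \<ge> 0" for t
    using that by (simp add: fun_eq_iff max_def)
  \<comment> \<open>At time 0 the finite integral is empty. As \<open>P\<close> annihilates the
    remaining limit, \<open>P o Y 0 = P\<close> follows.\<close>
  have Y0: "apply_bcontfun Y 0 = P - unstable_limit (apply_bcontfun Y)"
    using Y[of 0] by (simp add: G_def X_0)
  show ?thesis
  proof (intro exI[of _ "apply_bcontfun Y"] exI[of _ "norm Y"] conjI allI impI)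
    show "P o\<^sub>L apply_bcontfun Y 0 = P"
      by (simp add: Y0 blinfun_compose_diff_right P_P P_unstable_limit[OF Yc Yb])
    fix t :: real assume t: "0 \<le> t"
    have "Xi t o\<^sub>L G (apply_bcontfun Y) t = P + (integral {0..t} (op_integrand (apply_bcontfun Y)) - unstable_limit (apply_bcontfun Y))"
      unfolding G_def by (simp add: Xi_X[OF t] flip: blinfun_compose_assoc)
    then show "Xi t o\<^sub>L apply_bcontfun Y t = apply_bcontfun Y 0 + integral {0..t} (op_integrand (apply_bcontfun Y))"
      by (simp add: Y[OF t] Y0)
  qed (simp_all add: Yc Yb)
qed

text \<open>\<open>P R = P\<close> holds by construction and \<open>R P = R\<close> by uniqueness of
  bounded solutions; together \<open>R R = R P R = R P = R\<close>. Since \<open>P\<close> and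
  \<open>R\<close> have the same kernel, \<open>v - R v\<close> has no \<open>P\<close>
  part.\<close>

lemma perturbed_projection:
  "\<exists>R Y M. R o\<^sub>L R = R \<and> (\<forall>v. P (R v) = P v) \<and> Y 0 = R \<and> (\<forall>t\<ge>0. norm (Y t) \<le> M) \<and>
    (\<forall>v. mild_solution (\<lambda>t. Y t v))"
proof -
  obtain Y M where Yc: "continuous_on {0..} Y" and Yb: "\<And>t. t \<ge> 0 \<Longrightarrow> norm (Y t) \<le> M" and PY: "P o\<^sub>L Y 0 = P"
    and YI: "\<And>t. t \<ge> 0 \<Longrightarrow> Xi t o\<^sub>L Y t = Y 0 + integral {0..t} (op_integrand Y)"
    using bounded_operator_solution by blast
  have mild: "mild_solution (\<lambda>t. Y t v)" for v
    unfolding mild_solution_def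
  proof (intro conjI allI impI continuous_on_apply[OF Yc])
    fix t :: real assume "t \<ge> 0"
    from YI[OF this] have "(Xi t o\<^sub>L Y t) v = (Y 0 + integral {0..t} (op_integrand Y)) v" by simp
    then show "Xi t (Y t v) = Y 0 v + integral {0..t} (\<lambda>\<tau>. Xi \<tau> (B \<tau> (Y \<tau> v)))"
      by (simp add: blinfun.add_left op_integral_apply[OF Yc])
  qed
  have PY': "P (Y 0 v) = P v" for v
    using PY by (metis blinfun_apply_blinfun_compose)
  have "Y 0 (v - P v) = 0" for v
  proof -
    \<comment> \<open>With \<open>c\<close>, \<open>K\<close> and \<open>l\<close> all 0 the decay
      bound is a uniqueness statement: a bounded mild solution whose initial value has no
      \<open>P\<close> part vanishes.\<close>
    have "norm (Y 0 (v - P v)) \<le> 0 * exp (- 0 * (0 - 0))"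
    proof (rule stable_bound[OF mild, where c = 0 and s = 0 and M = "M * norm (v - P v)"])
      have "P (Y 0 (v - P v)) = 0" by (simp only: PY' blinfun.diff_right P_P_apply) simp
      then show "norm (X t (P (Xi 0 (Y 0 (v - P v))))) \<le> 0 * exp (- \<beta>1 * (t - 0))" for t
        by (simp add: Xi_0)
      show "norm (Y t (v - P v)) \<le> M * norm (v - P v)" if "t \<ge> 0" for t
        by (rule norm_blinfun_apply_le[OF Yb[OF that]])
    qed (use pos in simp_all)
    then show ?thesis by simp
  qed
  then have "Y 0 (P v) = Y 0 v" for v by (simp add: blinfun.diff_right)
  then have "Y 0 o\<^sub>L Y 0 = Y 0"
    by (intro blinfun_eqI) (metis PY' blinfun_apply_blinfun_compose)
  with PY' Yb mild show ?thesis by blast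
qed

text \<open>Variation of constants. Forwards, the integral formula is differentiated and uniqueness
  applies; backwards, differentiating \<open>Xi t (x t)\<close> cancels \<open>A\<close> and leaves
  the integrand \<open>Xi t (B t (x t))\<close>.\<close>

lemma mild_solution_iff_fundamental:
  assumes FA: "fundamental_solution A X Xi" and FAB: "fundamental_solution (\<lambda>t. A t + B t) \<Phi> \<Psi>"
  shows "mild_solution x \<longleftrightarrow> (\<forall>t\<ge>0. x t = \<Phi> t (x 0))"
proof
  assume x: "mild_solution x"
  define h where "h = (\<lambda>\<tau>. Xi \<tau> (B \<tau> (x \<tau>)))"
  have h: "continuous_on {0..} h"
    unfolding h_def by (intro blinfun.continuous_on cont_Xi cont_B mild_solution_cont[OF x])
  have xe: "x t = X t (x 0 + integral {0..t} h)" if "t \<ge> 0" for t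
    using x that X_Xi_apply[OF that, of "x t"] by (simp add: mild_solution_def h_def)
  have X_h: "X t (h t) = B t (x t)" if "t \<ge> 0" for t
    using that by (simp add: h_def X_Xi_apply)
  show "\<forall>t\<ge>0. x t = \<Phi> t (x 0)"
  proof (intro allI impI fundamental_solution_unique[OF FAB mild_solution_cont[OF x]])
    fix t :: real assume t: "t > 0"
    then have t0: "t \<ge> 0" by simp
    have "((\<lambda>t. x 0 + integral {0..t} h) has_vector_derivative 0 + h t) (at t within {0..})"
      by (intro has_vector_derivative_add has_vector_derivative_const integral_has_vector_derivative_half_line h t0)
    from blinfun_apply_has_vector_derivative[OF fundamental_solution_deriv(1)[OF FA t0] this]
    have "((\<lambda>t. X t (x 0 + integral {0..t} h)) has_vector_derivative (A t + B t) (x t)) (at t within {0..})"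
      by (simp only: xe[OF t0, symmetric] X_h[OF t0] blinfun.add_left blinfun_apply_blinfun_compose add_0 add.commute)
    then have "(x has_vector_derivative (A t + B t) (x t)) (at t within {0..})"
      by (rule has_vector_derivative_transform[rotated 2]) (use t0 in simp, rule xe, simp)
    moreover have "at t within {0..} = at t" by (intro at_within_interior) (simp add: t)
    ultimately show "(x has_vector_derivative (A t + B t) (x t)) (at t)" by simp
  qed
next
  assume x: "\<forall>t\<ge>0. x t = \<Phi> t (x 0)"
  have dx: "(x has_vector_derivative (A t + B t) (x t)) (at t within {0..})" if t: "t \<ge> 0" for t
  proof -
    from blinfun_apply_has_vector_derivative[OF fundamental_solution_deriv(1)[OF FAB t] has_vector_derivative_const[of "x 0"]]
    have "((\<lambda>t. \<Phi> t (x 0)) has_vector_derivative (A t + B t) (x t)) (at t within {0..})"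
      using x[rule_format, OF t] by simp
    then show ?thesis
      by (rule has_vector_derivative_transform[rotated 2]) (use t in simp, rule x[rule_format], simp)
  qed
  have "((\<lambda>\<tau>. Xi \<tau> (B \<tau> (x \<tau>))) has_integral Xi t (x t) - Xi 0 (x 0)) {0..t}" if t: "t \<ge> 0" for t
  proof (rule fundamental_theorem_of_calculus[OF t])
    fix s assume s: "s \<in> {0..t}"
    then have "0 \<le> s" by simp
    from blinfun_apply_has_vector_derivative[OF fundamental_solution_deriv(2)[OF FA this] dx[OF this]]
    have "((\<lambda>s. Xi s (x s)) has_vector_derivative Xi s (B s (x s))) (at s within {0..})"
      by (simp add: blinfun.add_left blinfun.add_right blinfun.minus_left)
    then show "((\<lambda>s. Xi s (x s)) has_vector_derivative Xi s (B s (x s))) (at s within {0..t})"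
      by (rule has_vector_derivative_within_subset) auto
  qed
  from integral_unique[OF this]
  have "Xi t (x t) = x 0 + integral {0..t} (\<lambda>\<tau>. Xi \<tau> (B \<tau> (x \<tau>)))" if "t \<ge> 0" for t
    using that by (simp add: Xi_0)
  moreover have "continuous_on {0..} x"
    by (rule continuous_on_vector_derivative, rule dx, simp)
  ultimately show "mild_solution x"
    unfolding mild_solution_def by blast
qed

end

section \<open>Rates of decay\<close>

text \<open>The hypotheses of the two decay bounds divided by the common factor
  \<open>exp (\<epsilon> * s) * norm (x s)\<close>. The unprimed constants belong to the part being
  estimated, the primed ones to the complementary part.\<close>

definition admissible_rate :: "real \<Rightarrow> real \<Rightarrow> real \<Rightarrow> real \<Rightarrow> real \<Rightarrow> real \<Rightarrow> real \<Rightarrow> bool" where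
  "admissible_rate N \<beta> N' \<beta>' \<delta> l K \<longleftrightarrow> 0 \<le> l \<and> l < \<beta> \<and> 0 \<le> K \<and>
     N + K * (N' * \<delta> / (\<beta>' + l)) \<le> K \<and>
     K * (N * \<delta> / (\<beta> - l)) + K * (N' * \<delta> / (\<beta>' + l)) \<le> K"

context
  fixes N \<beta> N' \<beta>' \<delta> \<theta> :: real
  assumes pos: "N > 0" "\<beta> > 0" "N' > 0" "\<beta>' > 0" "\<delta> \<ge> 0"
    and \<theta>: "\<theta> = \<delta> * (N / \<beta> + N' / \<beta>')" "\<theta> < 1"
begin

text \<open>The optimal rate itself equals \<open>\<beta>\<close> when \<open>\<delta> = 0\<close> and then is not admissible, so it is reached as a limit.\<close>

lemma bound_at_optimal_rate:
  assumes K: "K = N / (1 - \<theta>)" and "0 \<le> r" "0 \<le> c"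
    and H: "\<And>l. admissible_rate N \<beta> N' \<beta>' \<delta> l K \<Longrightarrow> u \<le> K * c * exp (- l * r)"
  shows "u \<le> K * c * exp (- (\<beta> - \<delta> * N / (1 - \<theta>)) * r)"
proof -
  define l1 where "l1 = \<beta> - \<delta> * N / (1 - \<theta>)"
  have K0: "K > 0" and KN: "K * (1 - \<theta>) = N" using pos \<theta> by (simp_all add: K)
  have th: "\<theta> = N * \<delta> / \<beta> + N' * \<delta> / \<beta>'" by (simp add: \<theta> algebra_simps)
  \<comment> \<open>The stated \<open>K\<close> is the solution of
    \<open>N + K * \<theta> = K\<close>.\<close>
  have KN': "N + K * (N * \<delta> / \<beta> + N' * \<delta> / \<beta>') = K"
    using KN by (simp flip: th add: algebra_simps)
  have nn: "0 \<le> N * \<delta> / \<beta>" "0 \<le> N' * \<delta> / \<beta>'" using pos by simp_all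
  have "u \<le> K * c * exp (- l1 * r)"
  proof (cases "l1 > 0")
    case True
    have "u \<le> K * c * exp (- l * r)" if l: "0 < l" "l < l1" for l
    proof (rule H)
      have lb: "\<delta> * N / (1 - \<theta>) < \<beta> - l" using l by (simp add: l1_def)
      moreover have d0: "0 \<le> \<delta> * N / (1 - \<theta>)" using pos \<theta> by simp
      ultimately have l': "l < \<beta>" by simp
      \<comment> \<open>A rate below \<open>l1\<close> makes
        \<open>K * (N * \<delta> / (\<beta> - l))\<close> at most \<open>N\<close>, so the second
        admissibility inequality follows from the first.\<close>
      from lb have "\<delta> * N \<le> (\<beta> - l) * (1 - \<theta>)" using \<theta>(2) by (simp add: pos_divide_less_eq)
      then have "N * \<delta> / (\<beta> - l) \<le> 1 - \<theta>" using l' by (simp add: field_simps)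
      from mult_left_mono[OF this, of K] have a: "K * (N * \<delta> / (\<beta> - l)) \<le> N" using K0 KN by simp
      have "N' * \<delta> / (\<beta>' + l) \<le> N' * \<delta> / \<beta>'" using pos l by (intro divide_left_mono) auto
      also have "\<dots> \<le> N * \<delta> / \<beta> + N' * \<delta> / \<beta>'" using nn by simp
      finally have b: "K * (N' * \<delta> / (\<beta>' + l)) \<le> K * (N * \<delta> / \<beta> + N' * \<delta> / \<beta>')"
        using K0 by (intro mult_left_mono) auto
      show "admissible_rate N \<beta> N' \<beta>' \<delta> l K"
        unfolding admissible_rate_def using l l' K0 a b KN' by linarith
    qed
    then have "\<forall>\<^sub>F l in at_left l1. u \<le> K * c * exp (- l * r)"
      using eventually_at_left_real[OF True] by (auto elim!: eventually_mono)
    moreover have "((\<lambda>l. K * c * exp (- l * r)) \<longlongrightarrow> K * c * exp (- l1 * r)) (at_left l1)"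
      by (intro tendsto_intros)
    ultimately show ?thesis
      by (intro tendsto_lowerbound) auto
  next
    case False
    \<comment> \<open>A nonpositive rate claims no decay: the rate 0 is admissible, and the
      exponential in the claim is at least 1.\<close>
    have "K * (N' * \<delta> / \<beta>') \<le> K * (N * \<delta> / \<beta> + N' * \<delta> / \<beta>')"
      using nn K0 by (intro mult_left_mono) auto
    then have "admissible_rate N \<beta> N' \<beta>' \<delta> 0 K"
      unfolding admissible_rate_def diff_zero add_0_right
      using pos K0 KN' by (simp only: distrib_left order_refl simp_thms) linarith
    from H[OF this] have "u \<le> K * c * 1" by simp
    also have "\<dots> \<le> K * c * exp (- l1 * r)"
      using False \<open>0 \<le> r\<close> \<open>0 \<le> c\<close> K0 by (intro mult_left_mono) (auto simp: mult_nonpos_nonneg)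
    finally show ?thesis .
  qed
  then show ?thesis by (simp add: l1_def)
qed

text \<open>The explicit rate need not be positive. At rate 0 the total coefficient \<open>f\<close>
  has the limit \<theta>, which is below 1, so by continuity some small positive rate still has
  \<open>f l < 1\<close>, with \<theta> replaced by \<open>f l\<close> in the formula for
  \<open>K\<close>.\<close>

lemma admissible_rate_exists: "\<exists>l>0. \<exists>K>0. admissible_rate N \<beta> N' \<beta>' \<delta> l K"
proof -
  define f where "f l = N * \<delta> / (\<beta> - l) + N' * \<delta> / (\<beta>' + l)" for l
  have "(f \<longlongrightarrow> N * \<delta> / (\<beta> - 0) + N' * \<delta> / (\<beta>' + 0)) (at_right 0)"
    unfolding f_def using pos by (intro tendsto_intros) auto
  moreover have "N * \<delta> / (\<beta> - 0) + N' * \<delta> / (\<beta>' + 0) = \<theta>"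
    by (simp add: \<theta> algebra_simps)
  ultimately have "\<forall>\<^sub>F l in at_right 0. f l < 1"
    using \<theta>(2) by (auto intro: order_tendstoD)
  then have "\<forall>\<^sub>F l in at_right 0. f l < 1 \<and> l \<in> {0<..<\<beta>}"
    using eventually_at_right_real[OF pos(2)] by (rule eventually_conj)
  then obtain l where l: "f l < 1" "0 < l" "l < \<beta>"
    using eventually_happens[of _ "at_right (0 :: real)"] by auto
  define K where "K = N / (1 - f l)"
  have K0: "K > 0" using l pos by (simp add: K_def)
  have "N + K * f l = K" using l by (simp add: K_def field_simps)
  moreover have "K * f l = K * (N * \<delta> / (\<beta> - l)) + K * (N' * \<delta> / (\<beta>' + l))"
    by (simp add: f_def distrib_left)
  moreover have "0 \<le> K * (N * \<delta> / (\<beta> - l))" using K0 l pos by simp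
  ultimately have "admissible_rate N \<beta> N' \<beta>' \<delta> l K"
    unfolding admissible_rate_def using l K0 pos by linarith
  then show ?thesis using l K0 by blast
qed

end

section \<open>Decay estimates at admissible rates\<close>

context perturbed_dichotomy begin

lemma stable_estimate:
  assumes x: "mild_solution x" and M: "\<And>t. t \<ge> 0 \<Longrightarrow> norm (x t) \<le> M" and st: "0 \<le> s" "s \<le> t"
    and ok: "admissible_rate N1 \<beta>1 N2 \<beta>2 \<delta> l K"
  shows "norm (x t) \<le> K * (exp (\<epsilon> * s) * norm (x s)) * exp (- l * (t - s))"
proof -
  let ?c = "exp (\<epsilon> * s) * norm (x s)"
  have c: "0 \<le> ?c" by simp
  from ok have l: "0 \<le> l" "l < \<beta>1" "0 \<le> K"
    and 1: "N1 + K * (N2 * \<delta> / (\<beta>2 + l)) \<le> K"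
    and 2: "K * (N1 * \<delta> / (\<beta>1 - l)) + K * (N2 * \<delta> / (\<beta>2 + l)) \<le> K"
    by (simp_all add: admissible_rate_def)
  show ?thesis
  proof (rule stable_bound[OF x M st(1) _ l(1,2) _ _ _ st(2)])
    fix t assume t: "s \<le> t"
    have "norm (X t (P (Xi s (x s)))) \<le> norm (X t o\<^sub>L P o\<^sub>L Xi s) * norm (x s)"
      using norm_blinfun[of "X t o\<^sub>L P o\<^sub>L Xi s" "x s"] by simp
    also have "\<dots> \<le> N1 * exp (- \<beta>1 * (t - s)) * exp (\<epsilon> * s) * norm (x s)"
      by (intro mult_right_mono bound_P st t norm_ge_zero)
    finally show "norm (X t (P (Xi s (x s)))) \<le> N1 * ?c * exp (- \<beta>1 * (t - s))"
      by (simp add: mult_ac)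
  next
    show "N1 * ?c + K * ?c * (N2 * \<delta> / (\<beta>2 + l)) \<le> K * ?c"
      using mult_right_mono[OF 1 c] by (simp add: algebra_simps)
    show "K * ?c * (N1 * \<delta> / (\<beta>1 - l)) + K * ?c * (N2 * \<delta> / (\<beta>2 + l)) \<le> K * ?c"
      using mult_right_mono[OF 2 c] by (simp add: algebra_simps)
  qed (use l in auto)
qed

lemma unstable_estimate:
  assumes x: "mild_solution x" and P0: "P (x 0) = 0" and ts: "0 \<le> t" "t \<le> s"
    and ok: "admissible_rate N2 \<beta>2 N1 \<beta>1 \<delta> l K"
  shows "norm (x t) \<le> K * (exp (\<epsilon> * s) * norm (x s)) * exp (- l * (s - t))"
proof -
  let ?c = "exp (\<epsilon> * s) * norm (x s)"
  have c: "0 \<le> ?c" by simp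
  from ok have l: "0 \<le> l" "l < \<beta>2" "0 \<le> K"
    and 1: "N2 + K * (N1 * \<delta> / (\<beta>1 + l)) \<le> K"
    and 2: "K * (N2 * \<delta> / (\<beta>2 - l)) + K * (N1 * \<delta> / (\<beta>1 + l)) \<le> K"
    by (simp_all add: admissible_rate_def)
  show ?thesis
  proof (rule unstable_bound[OF x P0 _ l(1,2) _ _ _ ts])
    fix t assume t: "0 \<le> t" "t \<le> s"
    have "norm (X t (Q (Xi s (x s)))) \<le> norm (X t o\<^sub>L Q o\<^sub>L Xi s) * norm (x s)"
      using norm_blinfun[of "X t o\<^sub>L Q o\<^sub>L Xi s" "x s"] by simp
    also have "\<dots> \<le> N2 * exp (- \<beta>2 * (s - t)) * exp (\<epsilon> * s) * norm (x s)"
      by (intro mult_right_mono bound_Q t norm_ge_zero)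
    finally show "norm (X t (Q (Xi s (x s)))) \<le> N2 * ?c * exp (- \<beta>2 * (s - t))"
      by (simp add: mult_ac)
  next
    show "N2 * ?c + K * ?c * (N1 * \<delta> / (\<beta>1 + l)) \<le> K * ?c"
      using mult_right_mono[OF 1 c] by (simp add: algebra_simps)
    show "K * ?c * (N2 * \<delta> / (\<beta>2 - l)) + K * ?c * (N1 * \<delta> / (\<beta>1 + l)) \<le> K * ?c"
      using mult_right_mono[OF 2 c] by (simp add: algebra_simps)
  qed (use l in auto)
qed

end

section \<open>Restricted norms and the return to conformable time\<close>

lemma restr_norm_le:
  assumes "V \<noteq> {}" "0 \<le> c" "\<And>v. v \<in> V \<Longrightarrow> norm (blinfun_apply S v) \<le> c * norm v"
  shows "restr_norm S V \<le> c"
  unfolding restr_norm_def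
proof (rule cSUP_least[OF \<open>V \<noteq> {}\<close>])
  fix v assume "v \<in> V"
  with assms show "norm (S v) / norm v \<le> c"
    \<comment> \<open>At \<open>v = 0\<close> the quotient is 0 by the convention for division, and
      \<open>0 \<le> c\<close> settles this case.\<close>
    by (cases "v = 0") (auto simp: divide_le_eq)
qed

text \<open>A vector in the range at time \<open>s\<close> has the form
  \<open>\<Phi> s (R w)\<close> in the new time, and the evolution carries it to
  \<open>\<Phi> t (R w)\<close>. The bounds along solutions are therefore bounds for the restricted
  evolution; likewise for \<open>w - R w\<close>.\<close>

lemma restricted_dichotomy_boundsI:
  fixes C \<Phi> \<Psi> :: "real \<Rightarrow> 'z::banach \<Rightarrow>\<^sub>L 'z" and R :: "'z \<Rightarrow>\<^sub>L 'z"
  assumes \<alpha>: "0 < \<alpha>" "\<alpha> \<le> 1" and C: "continuous_on {0..} C"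
    and FS: "fundamental_solution (\<lambda>\<tau>. C (conf_clock \<alpha> \<tau>)) \<Phi> \<Psi>"
    and K: "0 \<le> K1" "0 \<le> K2"
    and S: "\<And>s t v. 0 \<le> s \<Longrightarrow> s \<le> t \<Longrightarrow>
      norm (\<Phi> t (R v)) \<le> K1 * (exp (\<epsilon> * s) * norm (\<Phi> s (R v))) * exp (- l1 * (t - s))"
    and U: "\<And>s t v. 0 \<le> t \<Longrightarrow> t \<le> s \<Longrightarrow>
      norm (\<Phi> t (v - R v)) \<le> K2 * (exp (\<epsilon> * s) * norm (\<Phi> s (v - R v))) * exp (- l2 * (s - t))"
  shows "restricted_dichotomy_bounds \<alpha> (evolution_op \<alpha> C)
    (\<lambda>t. \<Phi> (conf_time \<alpha> t) o\<^sub>L R o\<^sub>L \<Psi> (conf_time \<alpha> t)) K1 K2 l1 l2 \<epsilon>"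
  unfolding restricted_dichotomy_bounds_def
proof (intro conjI allI impI; elim conjE)
  fix s t :: real assume st: "0 \<le> s" "s \<le> t"
  let ?s = "conf_time \<alpha> s" and ?t = "conf_time \<alpha> t"
  have st': "0 \<le> ?s" "?s \<le> ?t" using st \<alpha> by (auto intro: conf_time_nonneg conf_time_mono)
  show "restr_norm (evolution_op \<alpha> C t s) (range (\<Phi> ?s o\<^sub>L R o\<^sub>L \<Psi> ?s))
    \<le> K1 * (conf_exp \<alpha> l1 s / conf_exp \<alpha> l1 t) * conf_exp \<alpha> \<epsilon> s"
  proof (rule restr_norm_le, safe)
    fix v
    have "evolution_op \<alpha> C t s ((\<Phi> ?s o\<^sub>L R o\<^sub>L \<Psi> ?s) v) = \<Phi> ?t (R (\<Psi> ?s v))"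
      using st st' by (simp add: evolution_op_eq[OF \<alpha> C FS] fundamental_solution_inverse_apply(2)[OF FS])
    moreover have "exp (- l1 * (?t - ?s)) = conf_exp \<alpha> l1 s / conf_exp \<alpha> l1 t"
      by (simp add: conf_exp_eq[OF \<alpha>] algebra_simps flip: exp_diff)
    ultimately show "norm (evolution_op \<alpha> C t s ((\<Phi> ?s o\<^sub>L R o\<^sub>L \<Psi> ?s) v)) \<le>
        K1 * (conf_exp \<alpha> l1 s / conf_exp \<alpha> l1 t) * conf_exp \<alpha> \<epsilon> s * norm ((\<Phi> ?s o\<^sub>L R o\<^sub>L \<Psi> ?s) v)"
      using S[OF st', of "\<Psi> ?s v"] by (simp add: conf_exp_eq[OF \<alpha>] mult_ac)
  qed (use K in \<open>auto simp: conf_exp_def\<close>)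
next
  fix s t :: real assume ts: "0 \<le> t" "t \<le> s"
  let ?s = "conf_time \<alpha> s" and ?t = "conf_time \<alpha> t"
  have ts': "0 \<le> ?t" "?t \<le> ?s" using ts \<alpha> by (auto intro: conf_time_nonneg conf_time_mono)
  show "restr_norm (evolution_op \<alpha> C t s) (range (id_blinfun - (\<Phi> ?s o\<^sub>L R o\<^sub>L \<Psi> ?s)))
    \<le> K2 * (conf_exp \<alpha> l2 t / conf_exp \<alpha> l2 s) * conf_exp \<alpha> \<epsilon> s"
  proof (rule restr_norm_le, safe)
    fix v
    have "(id_blinfun - (\<Phi> ?s o\<^sub>L R o\<^sub>L \<Psi> ?s)) v = \<Phi> ?s (\<Psi> ?s v - R (\<Psi> ?s v))"
      using ts' by (simp add: blinfun.diff_left blinfun.diff_right fundamental_solution_inverse_apply(1)[OF FS])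
    moreover from this have "evolution_op \<alpha> C t s ((id_blinfun - (\<Phi> ?s o\<^sub>L R o\<^sub>L \<Psi> ?s)) v) = \<Phi> ?t (\<Psi> ?s v - R (\<Psi> ?s v))"
      using ts ts' by (simp add: evolution_op_eq[OF \<alpha> C FS] fundamental_solution_inverse_apply(2)[OF FS])
    moreover have "exp (- l2 * (?s - ?t)) = conf_exp \<alpha> l2 t / conf_exp \<alpha> l2 s"
      by (simp add: conf_exp_eq[OF \<alpha>] algebra_simps flip: exp_diff)
    ultimately show "norm (evolution_op \<alpha> C t s ((id_blinfun - (\<Phi> ?s o\<^sub>L R o\<^sub>L \<Psi> ?s)) v)) \<le>
        K2 * (conf_exp \<alpha> l2 t / conf_exp \<alpha> l2 s) * conf_exp \<alpha> \<epsilon> s * norm ((id_blinfun - (\<Phi> ?s o\<^sub>L R o\<^sub>L \<Psi> ?s)) v)"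
      using U[OF ts', of "\<Psi> ?s v"] by (simp add: conf_exp_eq[OF \<alpha>] mult_ac)
  qed (use K in \<open>auto simp: conf_exp_def\<close>)
qed

section \<open>Assembly of the perturbed dichotomy\<close>

theorem theorem5p2:
  fixes A B P :: "real \<Rightarrow> 'z::banach \<Rightarrow>\<^sub>L 'z"
    and \<alpha> \<delta> \<epsilon> N1 N2 \<beta>1 \<beta>2 \<theta> K1 K2 l1 l2 :: real
  assumes "0 < \<alpha>" and "\<alpha> \<le> 1"
    and "continuous_on {0..} A"
    and "continuous_on {0..} B" and "bounded (B ` {0..})"
    and "nonuniform_Mittag_Leffler_dichotomy \<alpha> A P N1 N2 \<beta>1 \<beta>2 \<epsilon>"
    and "\<And>t. t \<ge> 0 \<Longrightarrow> norm (B t) \<le> \<delta> / conf_exp \<alpha> \<epsilon> t"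
    and "\<theta> = \<delta> * (N1 / \<beta>1 + N2 / \<beta>2)" and "\<theta> < 1"
    and "\<epsilon> < min \<beta>1 \<beta>2"
    and "K1 = N1 / (1 - \<theta>)" and "K2 = N2 / (1 - \<theta>)"
    and "l1 = \<beta>1 - \<delta> * N1 / (1 - \<theta>)" and "l2 = \<beta>2 - \<delta> * N2 / (1 - \<theta>)"
  shows "\<exists>Q :: real \<Rightarrow> 'z \<Rightarrow>\<^sub>L 'z.
           projection_family Q \<and>
           invariant_under (evolution_op \<alpha> (\<lambda>t. A t + B t)) Q \<and>
           K1 > 0 \<and> K2 > 0 \<and>
           restricted_dichotomy_bounds \<alpha> (evolution_op \<alpha> (\<lambda>t. A t + B t)) Q K1 K2 l1 l2 \<epsilon> \<and>
           (\<exists>K1' K2' l1' l2'. K1' > 0 \<and> K2' > 0 \<and> l1' > 0 \<and> l2' > 0 \<and>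
              restricted_dichotomy_bounds \<alpha> (evolution_op \<alpha> (\<lambda>t. A t + B t)) Q K1' K2' l1' l2' \<epsilon>)"
proof -
  note \<alpha> = assms(1,2) and A = assms(3) and B = assms(4) and \<theta> = assms(8,9)
  let ?\<phi> = "conf_clock \<alpha>" and ?\<tau> = "conf_time \<alpha>"
  define C where "C = (\<lambda>t. A t + B t)"
  have C: "continuous_on {0..} C" unfolding C_def by (intro continuous_on_add A B)
  from assms(6) have pos: "N1 > 0" "N2 > 0" "\<beta>1 > 0" "\<beta>2 > 0"
    and proj: "\<And>t. t \<ge> 0 \<Longrightarrow> P t o\<^sub>L P t = P t"
    and inv: "\<And>t s. 0 \<le> s \<Longrightarrow> s \<le> t \<Longrightarrow> evolution_op \<alpha> A t s o\<^sub>L P s = P t o\<^sub>L evolution_op \<alpha> A t s"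
    and bP: "\<And>t s. 0 \<le> s \<Longrightarrow> s \<le> t \<Longrightarrow> norm (evolution_op \<alpha> A t s o\<^sub>L P s)
          \<le> N1 * (conf_exp \<alpha> \<beta>1 s / conf_exp \<alpha> \<beta>1 t) * conf_exp \<alpha> \<epsilon> s"
    and bQ: "\<And>t s. 0 \<le> t \<Longrightarrow> t \<le> s \<Longrightarrow> norm (evolution_op \<alpha> A t s o\<^sub>L (id_blinfun - P s))
          \<le> N2 * (conf_exp \<alpha> \<beta>2 t / conf_exp \<alpha> \<beta>2 s) * conf_exp \<alpha> \<epsilon> s"
    unfolding nonuniform_Mittag_Leffler_dichotomy_def projection_family_def invariant_under_def by blast+
  have clock: "continuous_on {0..} (\<lambda>\<tau>. L (?\<phi> \<tau>))" if "continuous_on {0..} L" for L :: "real \<Rightarrow> 'z \<Rightarrow>\<^sub>L 'z"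
    by (rule continuous_on_compose2[OF that continuous_on_conf_clock[OF \<alpha>]])
      (auto simp: conf_clock_nonneg[OF \<alpha>])
  obtain X Xi where FA: "fundamental_solution (\<lambda>\<tau>. A (?\<phi> \<tau>)) X Xi"
    using fundamental_solution_exists[OF clock[OF A]] by blast
  obtain \<Phi> \<Psi> where FC: "fundamental_solution (\<lambda>\<tau>. C (?\<phi> \<tau>)) \<Phi> \<Psi>"
    using fundamental_solution_exists[OF clock[OF C]] by blast
  note evA = evolution_op_eq[OF \<alpha> A FA] and evC = evolution_op_eq[OF \<alpha> C FC]
  note X0 = fundamental_solution_0[OF FA] fundamental_solution_inverse_0[OF FA]
  have ev: "evolution_op \<alpha> A (?\<phi> t) (?\<phi> s) = X t o\<^sub>L Xi s" if "0 \<le> s" "0 \<le> t" for s t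
    using that by (simp add: evA conf_clock_nonneg[OF \<alpha>] conf_time_clock[OF \<alpha>])
  have XiX: "Xi t o\<^sub>L X t = id_blinfun" "X t o\<^sub>L Xi t = id_blinfun" if "0 \<le> t" for t
    using fundamental_solution_inverse[OF FA that] by auto
  \<comment> \<open>Invariance from time 0 gives \<open>X s o P 0 = P (?\<phi> s) o X s\<close>, so
    the whole projection family is recovered from \<open>P 0\<close>.\<close>
  have evP: "evolution_op \<alpha> A (?\<phi> t) (?\<phi> s) o\<^sub>L P (?\<phi> s) = X t o\<^sub>L P 0 o\<^sub>L Xi s" if "0 \<le> s" "0 \<le> t" for s t
  proof -
    have "X s o\<^sub>L P 0 = P (?\<phi> s) o\<^sub>L X s"
      using inv[of 0 "?\<phi> s"] that ev[of 0 s] by (simp add: conf_clock_nonneg[OF \<alpha>] conf_clock_0[OF \<alpha>] X0)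
    then have "(X s o\<^sub>L P 0) o\<^sub>L Xi s = P (?\<phi> s)"
      by (simp add: blinfun_compose_assoc XiX that)
    then have "evolution_op \<alpha> A (?\<phi> t) (?\<phi> s) o\<^sub>L P (?\<phi> s) = X t o\<^sub>L ((Xi s o\<^sub>L X s) o\<^sub>L P 0 o\<^sub>L Xi s)"
      by (simp add: ev that blinfun_compose_assoc)
    then show ?thesis by (simp add: XiX that blinfun_compose_assoc)
  qed
  have ce: "conf_exp \<alpha> \<mu> (?\<phi> t) = exp (\<mu> * t)" if "0 \<le> t" for \<mu> t
    using that by (simp add: conf_exp_eq[OF \<alpha>] conf_time_clock[OF \<alpha>])
  interpret perturbed_dichotomy X Xi "\<lambda>\<tau>. B (?\<phi> \<tau>)" "P 0" N1 N2 \<beta>1 \<beta>2 \<epsilon> \<delta> \<theta>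
  proof
    show "continuous_on {0..} X" "continuous_on {0..} Xi"
      by (rule fundamental_solution_continuous[OF FA])+
    show "continuous_on {0..} (\<lambda>\<tau>. B (?\<phi> \<tau>))" by (rule clock[OF B])
    \<comment> \<open>At time 0 the weight is 1, so \<delta> dominates a norm.\<close>
    show "\<delta> \<ge> 0" using order_trans[OF norm_ge_zero assms(7)[of 0]] by (simp add: conf_exp_def)
    fix s t :: real
    assume st: "0 \<le> s" "s \<le> t"
    have "norm (X t o\<^sub>L P 0 o\<^sub>L Xi s) \<le> N1 * (exp (\<beta>1 * s) / exp (\<beta>1 * t)) * exp (\<epsilon> * s)"
      using bP[of "?\<phi> s" "?\<phi> t"] st conf_clock_mono[OF \<alpha> st]
      by (simp add: evP ce conf_clock_nonneg[OF \<alpha>])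
    also have "exp (\<beta>1 * s) / exp (\<beta>1 * t) = exp (- \<beta>1 * (t - s))"
      by (simp add: algebra_simps flip: exp_diff)
    finally show "norm (X t o\<^sub>L P 0 o\<^sub>L Xi s) \<le> N1 * exp (- \<beta>1 * (t - s)) * exp (\<epsilon> * s)" .
  next
    fix s t :: real
    assume ts: "0 \<le> t" "t \<le> s"
    then have s0: "0 \<le> s" by simp
    have "evolution_op \<alpha> A (?\<phi> t) (?\<phi> s) o\<^sub>L (id_blinfun - P (?\<phi> s)) = X t o\<^sub>L (id_blinfun - P 0) o\<^sub>L Xi s"
      unfolding blinfun_compose_diff_right
      unfolding evP[OF s0 ts(1)]
      unfolding ev[OF s0 ts(1)]
      by (simp add: blinfun_compose_diff_right blinfun_compose_diff_left)
    then have "norm (X t o\<^sub>L (id_blinfun - P 0) o\<^sub>L Xi s) \<le> N2 * (exp (\<beta>2 * t) / exp (\<beta>2 * s)) * exp (\<epsilon> * s)"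
      using bQ[of "?\<phi> t" "?\<phi> s"] ts conf_clock_mono[OF \<alpha> ts]
      by (simp add: ce conf_clock_nonneg[OF \<alpha>])
    also have "exp (\<beta>2 * t) / exp (\<beta>2 * s) = exp (- \<beta>2 * (s - t))"
      by (simp add: algebra_simps flip: exp_diff)
    finally show "norm (X t o\<^sub>L (id_blinfun - P 0) o\<^sub>L Xi s) \<le> N2 * exp (- \<beta>2 * (s - t)) * exp (\<epsilon> * s)" .
  next
    fix t :: real assume "t \<ge> 0"
    then show "norm (B (?\<phi> t)) \<le> \<delta> * exp (- \<epsilon> * t)"
      using assms(7)[of "?\<phi> t"] by (simp add: conf_clock_nonneg[OF \<alpha>] ce exp_minus divide_inverse)
  qed (use X0 XiX proj pos \<theta> assms(10) in auto)
  obtain R Y M where RR: "R o\<^sub>L R = R" and PR: "\<And>v. P 0 (R v) = P 0 v" and Y0: "Y 0 = R"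
    and YM: "\<And>t. t \<ge> 0 \<Longrightarrow> norm (Y t) \<le> M" and mild_Y: "\<And>v. mild_solution (\<lambda>t. Y t v)"
    using perturbed_projection by blast
  note mild_iff = mild_solution_iff_fundamental[OF FA FC[unfolded C_def]]
  have mild: "mild_solution (\<lambda>t. \<Phi> t v)" for v
    using mild_iff[of "\<lambda>t. \<Phi> t v"] by (simp add: fundamental_solution_0[OF FC])
  have Y\<Phi>: "Y t v = \<Phi> t (R v)" if "t \<ge> 0" for t v
    using mild_Y[of v] mild_iff[of "\<lambda>t. Y t v"] that by (simp add: Y0)
  \<comment> \<open>Solutions starting in the range of \<open>R\<close> are columns
    \<open>Y t v\<close> of the bounded fixed point, which supplies the global bound required by
    \<open>stable_estimate\<close>.\<close>
  have bnd: "norm (\<Phi> t (R v)) \<le> M * norm v" if "t \<ge> 0" for t v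
    using norm_blinfun_apply_le[OF YM[OF that], of v] by (simp add: Y\<Phi> that)
  have S: "norm (\<Phi> t (R v)) \<le> K * (exp (\<epsilon> * s) * norm (\<Phi> s (R v))) * exp (- l * (t - s))"
    if "0 \<le> s" "s \<le> t" "admissible_rate N1 \<beta>1 N2 \<beta>2 \<delta> l K" for s t v l K
    by (rule stable_estimate[OF mild bnd that])
  \<comment> \<open>Here \<open>P 0 (v - R v) = 0\<close>, so the boundary term at 0 vanishes as
    \<open>unstable_estimate\<close> requires.\<close>
  have U: "norm (\<Phi> t (v - R v)) \<le> K * (exp (\<epsilon> * s) * norm (\<Phi> s (v - R v))) * exp (- l * (s - t))"
    if "0 \<le> t" "t \<le> s" "admissible_rate N2 \<beta>2 N1 \<beta>1 \<delta> l K" for s t v l K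
    by (rule unstable_estimate[OF mild _ that])
      (simp add: fundamental_solution_0[OF FC] blinfun.diff_right PR)
  define Q' where "Q' t = (\<Phi> (?\<tau> t) o\<^sub>L R o\<^sub>L \<Psi> (?\<tau> t))" for t
  note boundsI = restricted_dichotomy_boundsI[OF \<alpha> C FC, of _ _ R, folded Q'_def]
  have \<theta>': "\<theta> = \<delta> * (N2 / \<beta>2 + N1 / \<beta>1)" using \<theta>(1) by (simp add: add.commute)
  have \<delta>: "\<delta> \<ge> 0" using pos by simp
  show ?thesis
  proof (intro exI[of _ Q'] conjI)
    show "projection_family Q'"
      unfolding projection_family_def
    proof (intro allI impI blinfun_eqI)
      fix t v
      have "R (R w) = R w" for w using RR by (metis blinfun_apply_blinfun_compose)
      then show "(Q' t o\<^sub>L Q' t) v = Q' t v"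
        by (simp add: Q'_def fundamental_solution_inverse_apply(2)[OF FC conf_time_nonneg[OF \<alpha>]])
    qed
    show "invariant_under (evolution_op \<alpha> (\<lambda>t. A t + B t)) Q'"
      unfolding invariant_under_def C_def[symmetric]
    proof (intro allI impI blinfun_eqI; elim conjE)
      fix t s v assume "0 \<le> s" "s \<le> (t :: real)"
      then show "(evolution_op \<alpha> C t s o\<^sub>L Q' s) v = (Q' t o\<^sub>L evolution_op \<alpha> C t s) v"
        by (simp add: Q'_def evC fundamental_solution_inverse_apply(2)[OF FC conf_time_nonneg[OF \<alpha>]])
    qed
    show K: "K1 > 0" "K2 > 0" using assms pos by auto
    show "restricted_dichotomy_bounds \<alpha> (evolution_op \<alpha> (\<lambda>t. A t + B t)) Q' K1 K2 l1 l2 \<epsilon>"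
      unfolding C_def[symmetric]
    proof (rule boundsI)
      fix s t v assume st: "0 \<le> s" "s \<le> (t :: real)"
      show "norm (\<Phi> t (R v)) \<le> K1 * (exp (\<epsilon> * s) * norm (\<Phi> s (R v))) * exp (- l1 * (t - s))"
        unfolding assms(13)
        by (rule bound_at_optimal_rate[OF _ _ _ _ _ \<theta> assms(11)]) (use pos st S[OF st] in auto)
    next
      fix s t v assume ts: "0 \<le> t" "t \<le> (s :: real)"
      show "norm (\<Phi> t (v - R v)) \<le> K2 * (exp (\<epsilon> * s) * norm (\<Phi> s (v - R v))) * exp (- l2 * (s - t))"
        unfolding assms(14)
        by (rule bound_at_optimal_rate[OF _ _ _ _ _ \<theta>' \<theta>(2) assms(12)]) (use pos ts U[OF ts] in auto)
    qed (use K in auto)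
    \<comment> \<open>Because \<open>l1\<close> and \<open>l2\<close> may fail to be positive,
      genuine decay is shown with separately chosen constants for the same projections.\<close>
    obtain l1' K1' where 1: "l1' > 0" "K1' > 0" "admissible_rate N1 \<beta>1 N2 \<beta>2 \<delta> l1' K1'"
      using admissible_rate_exists[OF pos(1,3,2,4) \<delta> \<theta>] by blast
    obtain l2' K2' where 2: "l2' > 0" "K2' > 0" "admissible_rate N2 \<beta>2 N1 \<beta>1 \<delta> l2' K2'"
      using admissible_rate_exists[OF pos(2,4,1,3) \<delta> \<theta>' \<theta>(2)] by blast
    have "restricted_dichotomy_bounds \<alpha> (evolution_op \<alpha> C) Q' K1' K2' l1' l2' \<epsilon>"
      by (rule boundsI) (use 1 2 S U in auto)
    with 1 2 show "\<exists>K1' K2' l1' l2'. K1' > 0 \<and> K2' > 0 \<and> l1' > 0 \<and> l2' > 0 \<and>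
        restricted_dichotomy_bounds \<alpha> (evolution_op \<alpha> (\<lambda>t. A t + B t)) Q' K1' K2' l1' l2' \<epsilon>"
      unfolding C_def by blast
  qed
qed

end
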